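(* Let $\Sigma$ be a finite alphabet and let $L \subseteq \Sigma^*$ be a regular language. The following statements are equivalent: (1) $L \in \mathsf{F}(\mathcal{O}(\log n))$; (2) $L \in \mathsf{V}(\mathcal{O}(\log n))$; (3) the reversal $L^\mathsf{R}$ is recognized by a well-behaved DFA; (4) $L$ is $\leftarrow$-reducible to a regular language of polynomial growth; (5) $L$ is a Boolean combination of regular left ideals and regular length languages.
   Context: A streaming algorithm over a finite alphabet $\Gamma$ is a deterministic (possibly infinite-state) automaton $(S,\Gamma,s_0,\delta,F)$ together with an injective encoding $\mathrm{enc}\colon S\to\{0,1\}^*$; for $w\in\Gamma^*$, $\mathrm{space}(\mathcal{A},w)=\max\{|\mathrm{enc}(\mathcal{A}(u))| : u \text{ a prefix of } w\}$, where $\mathcal{A}(u)$ is the state reached from $s_0$ on $u$. Fixed-size model: fix a symbol $a\in\Sigma$; for $w=a_1\cdots a_m$ and $n\ge0$, $\mathrm{last}_n(w)=a_{m-n+1}\cdots a_m$ if $n\le m$ and $a^{n-m}a_1\cdots a_m$ otherwise. A fixed-size sliding window algorithm for $L$ is a sequence $(\mathcal{A}_n)_{n\ge0}$ where $\mathcal{A}_n$ is a streaming algorithm over $\Sigma$ accepting $\{w : \mathrm{last}_n(w)\in L\}$; its space complexity at $n$ is the maximal encoding length of a state of $\mathcal{A}_n$. Variable-size model: let $\overline\Sigma=\Sigma\cup\{\downarrow\}$; define $\mathrm{wnd}\colon\overline\Sigma^*\to\Sigma^*$ by $\mathrm{wnd}(\varepsilon)=\varepsilon$, $\mathrm{wnd}(ub)=\mathrm{wnd}(u)b$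 for $b\in\Sigma$, $\mathrm{wnd}(u\!\downarrow)=\varepsilon$ if $\mathrm{wnd}(u)=\varepsilon$, and $\mathrm{wnd}(u\!\downarrow)=v$ if $\mathrm{wnd}(u)=bv$ with $b\in\Sigma$. A variable-size sliding window algorithm for $L$ is a streaming algorithm $\mathcal{A}$ over $\overline\Sigma$ accepting $\{w:\mathrm{wnd}(w)\in L\}$; its space complexity is $v_\mathcal{A}(n)=\max\{\mathrm{space}(\mathcal{A},u): |\mathrm{wnd}(v)|\le n \text{ for all prefixes } v \text{ of } u\}$. For $s\colon\mathbb{N}\to\mathbb{N}$, $\mathsf{F}(s)$ (resp. $\mathsf{V}(s)$) is the class of languages having a fixed-size (resp. variable-size) sliding window algorithm with space complexity at most $s(n)$ for all $n$, and $\mathsf{X}(\mathcal{O}(g))=\bigcup_{s\in\mathcal{O}(g)}\mathsf{X}(s)$. A strongly connected component (SCC) of a DFA $(Q,\Sigma,q_0,\delta,F)$ is an inclusion-maximal $C\subseteq Q$ such that any two states of $C$ are mutually reachable. An SCC $C$ is well-behaved if for all $q\in C$ and $u,v\in\Sigma^*$ with $|u|=|v|$ and $\delta(q,u),\delta(q,v)\in C$: $\delta(q,u)\in F$ iff $\delta(q,v)\in F$. The DFA is well-behaved if every SCC reachable from $q_0$ is well-behaved. $L^\mathsf{R}=\{x^\mathsf{R}:x\in L\}$ (word reversal). A Mealy machine $(Q,\Sigma,\Gamma,q_0,\delta)$ with $\delta\colon Q\times\Sigma\to Q\times\Gamma$ defines $\tau_q$ by $\tau_q(\varepsilon)=\varepsilon$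 and $\tau_p(bu)=c\,\tau_q(u)$ if $\delta(p,b)=(q,c)$; the $\leftarrow$-transduction it computes is $x\mapsto \tau_{q_0}(x^\mathsf{R})^\mathsf{R}$. A $\leftarrow$-reduction from $K\subseteq\Sigma^*$ to $L'\subseteq\Gamma^*$ is a $\leftarrow$-transduction $\tau$ with $x\in K \iff \tau(x)\in L'$ for all $x$. The growth of $L'$ is $g(n)=|\{x\in L':|x|\le n\}|$; polynomial growth means $g(n)\in\mathcal{O}(n^d)$ for some $d$. $L$ is a left ideal if $\Sigma^*L\subseteq L$; a length language if for every $n$ either $\Sigma^n\subseteq L$ or $L\cap\Sigma^n=\emptyset$. *)

theory Defs
  imports Complex_Main "HOL-Library.Landau_Symbols"
begin

definition run :: "('s \<Rightarrow> 'g \<Rightarrow> 's) \<Rightarrow> 's \<Rightarrow> 'g list \<Rightarrow> 's" where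
  "run \<delta> s w = foldl \<delta> s w"

record 'g salg =
  st    :: "nat set"
  init  :: nat
  trans :: "nat \<Rightarrow> 'g \<Rightarrow> nat"
  acc   :: "nat set"
  enc   :: "nat \<Rightarrow> bool list"

definition streaming_alg :: "'g salg \<Rightarrow> bool" where
  "streaming_alg A \<longleftrightarrow> init A \<in> st A \<and> (\<forall>q\<in>st A. \<forall>c. trans A q c \<in> st A)
     \<and> acc A \<subseteq> st A \<and> inj_on (enc A) (st A)"

definition salg_lang :: "'g salg \<Rightarrow> 'g list set" where
  "salg_lang A = {w. run (trans A) (init A) w \<in> acc A}"

definition space :: "'g salg \<Rightarrow> 'g list \<Rightarrow> nat" where
  "space A w = Max ((\<lambda>i. length (enc A (run (trans A) (init A) (take i w)))) ` {0..length w})"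

definition lastn :: "'a \<Rightarrow> nat \<Rightarrow> 'a list \<Rightarrow> 'a list" where
  "lastn a n w = (if n \<le> length w then drop (length w - n) w else replicate (n - length w) a @ w)"

definition F_class :: "'a \<Rightarrow> (nat \<Rightarrow> nat) \<Rightarrow> 'a list set set" where
  "F_class a s = {L. \<exists>A :: nat \<Rightarrow> 'a salg. \<forall>n.
       streaming_alg (A n) \<and> salg_lang (A n) = {w. lastn a n w \<in> L}
     \<and> (\<forall>q\<in>st (A n). length (enc (A n) q) \<le> s n)}"

definition F_log :: "'a \<Rightarrow> 'a list set set" where
  "F_log a = (\<Union>s \<in> {s :: nat \<Rightarrow> nat. (\<lambda>n. real (s n)) \<in> O(\<lambda>n. ln (real n))}. F_class a s)"

section \<open>Variable-size sliding window model (None encodes the pop symbol)\<close>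

definition wnd :: "'a option list \<Rightarrow> 'a list" where
  "wnd w = foldl (\<lambda>v c. case c of Some b \<Rightarrow> v @ [b] | None \<Rightarrow> tl v) [] w"

definition V_class :: "(nat \<Rightarrow> nat) \<Rightarrow> 'a list set set" where
  "V_class s = {L. \<exists>A :: 'a option salg.
       streaming_alg A \<and> salg_lang A = {w. wnd w \<in> L}
     \<and> (\<forall>n u. (\<forall>i\<le>length u. length (wnd (take i u)) \<le> n) \<longrightarrow> space A u \<le> s n)}"

definition V_log :: "'a list set set" where
  "V_log = (\<Union>s \<in> {s :: nat \<Rightarrow> nat. (\<lambda>n. real (s n)) \<in> O(\<lambda>n. ln (real n))}. V_class s)"

definition dfa :: "'g set \<Rightarrow> nat set \<Rightarrow> nat \<Rightarrow> (nat \<Rightarrow> 'g \<Rightarrow> nat) \<Rightarrow> nat set \<Rightarrow> bool" where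
  "dfa Sig Q q0 \<delta> F \<longleftrightarrow> finite Q \<and> q0 \<in> Q \<and> (\<forall>q\<in>Q. \<forall>c\<in>Sig. \<delta> q c \<in> Q) \<and> F \<subseteq> Q"

definition dfa_lang :: "'g set \<Rightarrow> nat \<Rightarrow> (nat \<Rightarrow> 'g \<Rightarrow> nat) \<Rightarrow> nat set \<Rightarrow> 'g list set" where
  "dfa_lang Sig q0 \<delta> F = {w \<in> lists Sig. run \<delta> q0 w \<in> F}"

definition regular_on :: "'g set \<Rightarrow> 'g list set \<Rightarrow> bool" where
  "regular_on Sig L \<longleftrightarrow> (\<exists>Q q0 \<delta> F. dfa Sig Q q0 \<delta> F \<and> L = dfa_lang Sig q0 \<delta> F)"

abbreviation regular :: "'g list set \<Rightarrow> bool" where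
  "regular L \<equiv> regular_on UNIV L"

definition reach :: "'g set \<Rightarrow> (nat \<Rightarrow> 'g \<Rightarrow> nat) \<Rightarrow> nat \<Rightarrow> nat \<Rightarrow> bool" where
  "reach Sig \<delta> p q \<longleftrightarrow> (\<exists>u \<in> lists Sig. run \<delta> p u = q)"

definition mutually_reachable :: "'g set \<Rightarrow> (nat \<Rightarrow> 'g \<Rightarrow> nat) \<Rightarrow> nat set \<Rightarrow> bool" where
  "mutually_reachable Sig \<delta> C \<longleftrightarrow> (\<forall>p\<in>C. \<forall>q\<in>C. reach Sig \<delta> p q \<and> reach Sig \<delta> q p)"

definition is_scc :: "'g set \<Rightarrow> nat set \<Rightarrow> (nat \<Rightarrow> 'g \<Rightarrow> nat) \<Rightarrow> nat set \<Rightarrow> bool" where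
  "is_scc Sig Q \<delta> C \<longleftrightarrow> C \<subseteq> Q \<and> mutually_reachable Sig \<delta> C
     \<and> (\<forall>D. C \<subseteq> D \<and> D \<subseteq> Q \<and> mutually_reachable Sig \<delta> D \<longrightarrow> D = C)"

definition well_behaved_scc :: "'g set \<Rightarrow> (nat \<Rightarrow> 'g \<Rightarrow> nat) \<Rightarrow> nat set \<Rightarrow> nat set \<Rightarrow> bool" where
  "well_behaved_scc Sig \<delta> F C \<longleftrightarrow> (\<forall>q\<in>C. \<forall>u\<in>lists Sig. \<forall>v\<in>lists Sig.
      length u = length v \<and> run \<delta> q u \<in> C \<and> run \<delta> q v \<in> C
        \<longrightarrow> (run \<delta> q u \<in> F \<longleftrightarrow> run \<delta> q v \<in> F))"

definition well_behaved_dfa :: "'g set \<Rightarrow> nat set \<Rightarrow> nat \<Rightarrow> (nat \<Rightarrow> 'g \<Rightarrow> nat) \<Rightarrow> nat set \<Rightarrow> bool" where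
  "well_behaved_dfa Sig Q q0 \<delta> F \<longleftrightarrow> dfa Sig Q q0 \<delta> F \<and>
     (\<forall>C. is_scc Sig Q \<delta> C \<and> (\<exists>q\<in>C. reach Sig \<delta> q0 q) \<longrightarrow> well_behaved_scc Sig \<delta> F C)"

definition rev_lang :: "'g list set \<Rightarrow> 'g list set" where
  "rev_lang L = rev ` L"

primrec mealy_out :: "(nat \<Rightarrow> 'a \<Rightarrow> nat \<times> 'b) \<Rightarrow> nat \<Rightarrow> 'a list \<Rightarrow> 'b list" where
  "mealy_out \<delta> p [] = []"
| "mealy_out \<delta> p (b # u) = snd (\<delta> p b) # mealy_out \<delta> (fst (\<delta> p b)) u"

definition mealy :: "nat set \<Rightarrow> 'b set \<Rightarrow> nat \<Rightarrow> (nat \<Rightarrow> 'a \<Rightarrow> nat \<times> 'b) \<Rightarrow> bool" where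
  "mealy Q Gam q0 \<delta> \<longleftrightarrow> finite Q \<and> q0 \<in> Q \<and>
     (\<forall>q\<in>Q. \<forall>b. fst (\<delta> q b) \<in> Q \<and> snd (\<delta> q b) \<in> Gam)"

definition left_transduction :: "(nat \<Rightarrow> 'a \<Rightarrow> nat \<times> 'b) \<Rightarrow> nat \<Rightarrow> 'a list \<Rightarrow> 'b list" where
  "left_transduction \<delta> q0 x = rev (mealy_out \<delta> q0 (rev x))"

definition growth :: "'b list set \<Rightarrow> nat \<Rightarrow> nat" where
  "growth L n = card {x \<in> L. length x \<le> n}"

definition poly_growth :: "'b list set \<Rightarrow> bool" where
  "poly_growth L \<longleftrightarrow> (\<exists>d::nat. (\<lambda>n. real (growth L n)) \<in> O(\<lambda>n. real n ^ d))"

definition left_reducible_to_regular_poly :: "'a list set \<Rightarrow> bool" where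
  "left_reducible_to_regular_poly L \<longleftrightarrow>
     (\<exists>(Gam :: nat set) Q q0 (\<delta> :: nat \<Rightarrow> 'a \<Rightarrow> nat \<times> nat) L'.
        finite Gam \<and> mealy Q Gam q0 \<delta> \<and> L' \<subseteq> lists Gam \<and> regular_on Gam L'
        \<and> poly_growth L' \<and> (\<forall>x. x \<in> L \<longleftrightarrow> left_transduction \<delta> q0 x \<in> L'))"

definition left_ideal :: "'a list set \<Rightarrow> bool" where
  "left_ideal L \<longleftrightarrow> (\<forall>u w. w \<in> L \<longrightarrow> u @ w \<in> L)"

definition length_language :: "'a list set \<Rightarrow> bool" where
  "length_language L \<longleftrightarrow> (\<forall>n. (\<forall>w. length w = n \<longrightarrow> w \<in> L) \<or> (\<forall>w. length w = n \<longrightarrow> w \<notin> L))"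

inductive bool_comb :: "'x set set \<Rightarrow> 'x set \<Rightarrow> bool" for G where
  base: "X \<in> G \<Longrightarrow> bool_comb G X"
| compl: "bool_comb G X \<Longrightarrow> bool_comb G (- X)"
| inter: "bool_comb G X \<Longrightarrow> bool_comb G Y \<Longrightarrow> bool_comb G (X \<inter> Y)"

end

theory Submission
  imports Defs "HOL-Library.FuncSet" "HOL-Library.Countable_Set" "HOL-Real_Asymp.Real_Asymp"
begin

text \<open>A language has a variable-size algorithm with logarithmic space iff the Myhill-Nerode classes of
  windows under pushes and pops are polynomially many in the window length; this property is
  preserved by Boolean operations.

  Variable-size to fixed-size: simulate a push by a pop followed by a push. Fixed-size to well-behaved:
  a strongly connected component that is not well-behaved contains a state with two loops of equal
  length whose order can be recovered from suitable suffixes, so \<open>2\<^sup>k\<close> streams have to be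
  distinguished by windows of length linear in \<open>k\<close>. Well-behaved to reducible: output the path summary,
  that is, the entry state of the current component. Reducible to variable-size: for each state of the
  Mealy machine, the longest suffix of its output on the window that is a factor of the target language
  determines the class of the window, and a regular language of polynomial growth has polynomially
  many factors.

  For Boolean combinations: a word is accepted iff for some final state \<open>e\<close> its reversal visits \<open>e\<close>
  at a position \<open>i\<close>, ends in a state from which \<open>e\<close> is reachable, and has length congruent to \<open>i\<close>
  modulo the length of a loop at \<open>e\<close>.\<close>

section \<open>Automata\<close>

lemma run_Nil [simp]: "run d q [] = q"
  and run_Cons [simp]: "run d q (c # w) = run d (d q c) w"
  and run_append [simp]: "run d q (u @ v) = run d (run d q u) v"
  by (simp_all add: run_def)

lemma run_concat_replicate:
  assumes "run d q z = q"
  shows "run d q (concat (replicate k z)) = q"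
  using assms by (induction k) auto

lemma dfa_run_in:
  assumes "dfa Sig Q q0 d F" "q \<in> Q" "w \<in> lists Sig"
  shows "run d q w \<in> Q"
  using assms(3,2) by (induction w arbitrary: q) (use assms(1) in \<open>auto simp: dfa_def\<close>)

text \<open>The values of a right congruence \<open>h\<close> can themselves be states: a transition
  is computed on a representative word, and \<open>cong\<close> makes its choice irrelevant. This
  supplies both the DFAs of \<open>regular_onI\<close> and the possibly infinite streaming algorithm
  of \<open>V_logI\<close>.\<close>

lemma transition_exists:
  assumes cong: "\<And>u v c. u \<in> lists Sig \<Longrightarrow> v \<in> lists Sig \<Longrightarrow> c \<in> Sig \<Longrightarrow> h u = h v
                   \<Longrightarrow> h (u @ [c]) = h (v @ [c])"
  shows "\<exists>d. (\<forall>w\<in>lists Sig. \<forall>c\<in>Sig. d (h w) c = h (w @ [c])) \<and>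
             (\<forall>w\<in>lists Sig. run d (h []) w = h w)"
proof -
  define r where "r k = (SOME w. w \<in> lists Sig \<and> h w = k)" for k
  define d where "d k c = h (r k @ [c])" for k c
  have r: "r (h w) \<in> lists Sig \<and> h (r (h w)) = h w" if "w \<in> lists Sig" for w
    unfolding r_def by (rule someI[of _ w]) (use that in auto)
  have d: "d (h w) c = h (w @ [c])" if "w \<in> lists Sig" "c \<in> Sig" for w c
    unfolding d_def by (rule cong) (use r[OF that(1)] that in auto)
  moreover have "run d (h []) w = h w" if "w \<in> lists Sig" for w
    using that by (induction w rule: rev_induct) (auto simp: d)
  ultimately show ?thesis by blast
qed

text \<open>The easy half of Myhill-Nerode. Values of \<open>f\<close> may have any type, whereas
  states are natural numbers, hence the numbering \<open>h\<close>.\<close>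

lemma regular_onI:
  assumes fin: "finite (f ` lists Sig)" and sub: "L \<subseteq> lists Sig"
    and cong: "\<And>u v c. u \<in> lists Sig \<Longrightarrow> v \<in> lists Sig \<Longrightarrow> c \<in> Sig \<Longrightarrow> f u = f v
                 \<Longrightarrow> f (u @ [c]) = f (v @ [c])"
    and sat: "\<And>u v. u \<in> lists Sig \<Longrightarrow> v \<in> lists Sig \<Longrightarrow> f u = f v \<Longrightarrow> u \<in> L \<Longrightarrow> v \<in> L"
  shows "regular_on Sig L"
proof -
  define h where "h w = to_nat_on (f ` lists Sig) (f w)" for w
  have inj: "inj_on (to_nat_on (f ` lists Sig)) (f ` lists Sig)"
    by (rule inj_on_to_nat_on) (use fin in \<open>simp add: countable_finite\<close>)
  have h: "h u = h v \<longleftrightarrow> f u = f v" if "u \<in> lists Sig" "v \<in> lists Sig" for u v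
    unfolding h_def using inj_on_eq_iff[OF inj] that by blast
  have cong_h: "h (u @ [c]) = h (v @ [c])"
    if "u \<in> lists Sig" "v \<in> lists Sig" "c \<in> Sig" "h u = h v" for u v c
    using that cong[of u v c] h[of u v] h[of "u @ [c]" "v @ [c]"] by simp
  obtain d where d: "\<And>w c. w \<in> lists Sig \<Longrightarrow> c \<in> Sig \<Longrightarrow> d (h w) c = h (w @ [c])"
    and rd: "\<And>w. w \<in> lists Sig \<Longrightarrow> run d (h []) w = h w"
    using transition_exists[where Sig = Sig and h = h, OF cong_h] by blast
  have "h ` lists Sig = to_nat_on (f ` lists Sig) ` f ` lists Sig"
    by (auto simp: h_def image_image)
  hence "finite (h ` lists Sig)" using fin by auto
  hence "dfa Sig (h ` lists Sig) (h []) d (h ` L)"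
    unfolding dfa_def using sub by (auto simp: d simp del: in_lists_conv_set)
  moreover have "L = dfa_lang Sig (h []) d (h ` L)"
  proof -
    have "h w \<in> h ` L \<longleftrightarrow> w \<in> L" if "w \<in> lists Sig" for w
      using sat[OF _ that] h[OF that] sub that by (metis imageE imageI subsetD)
    hence "x \<in> L \<longleftrightarrow> x \<in> lists Sig \<and> run d (h []) x \<in> h ` L" for x
      using rd[of x] sub by (metis subsetD)
    thus ?thesis unfolding dfa_lang_def by blast
  qed
  ultimately show ?thesis unfolding regular_on_def by blast
qed

lemma regularI:
  fixes L :: "'a list set"
  assumes "finite (range f)"
    and "\<And>u v c. f u = f v \<Longrightarrow> f (u @ [c]) = f (v @ [c])"
    and "\<And>u v. f u = f v \<Longrightarrow> u \<in> L \<Longrightarrow> v \<in> L"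
  shows "regular L"
proof (rule regular_onI[of f])
  show "finite (f ` lists UNIV)" using assms(1) by (simp add: lists_UNIV)
qed (use assms(2,3) in blast)+

section \<open>Reversal of regular languages\<close>

lemma rev_lang_iff [simp]: "rev x \<in> rev_lang L \<longleftrightarrow> x \<in> L"
  unfolding rev_lang_def by (metis image_iff rev_rev_ident)

lemma rev_lang_iff': "x \<in> rev_lang L \<longleftrightarrow> rev x \<in> L"
  by (metis rev_lang_iff rev_rev_ident)

text \<open>Subset construction for the reversed automaton: \<open>f v\<close> collects the states
  from which \<open>rev v\<close> leads to \<open>F\<close>, and appending \<open>c\<close> to
  \<open>v\<close> takes the preimage of this set under \<open>c\<close>.\<close>

lemma regular_rev_lang:
  fixes L :: "'a list set"
  assumes "regular L"
  shows "regular (rev_lang L)"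
proof -
  obtain Q q0 d F where A: "dfa UNIV Q q0 d F" "L = dfa_lang UNIV q0 d F"
    using assms by (auto simp: regular_on_def)
  define f where "f v = {q \<in> Q. run d q (rev v) \<in> F}" for v
  show ?thesis
  proof (rule regularI[of f])
    have "range f \<subseteq> Pow Q" by (auto simp: f_def)
    thus "finite (range f)" using A(1) by (meson dfa_def finite_Pow_iff finite_subset)
    show "f (u @ [c]) = f (v @ [c])" if "f u = f v" for u v c
    proof -
      have *: "f (w @ [c]) = {q \<in> Q. d q c \<in> f w}" for w
        using A(1) by (auto simp: f_def dfa_def)
      show ?thesis by (simp add: * that)
    qed
    have "v \<in> rev_lang L \<longleftrightarrow> q0 \<in> f v" for v
      using A by (auto simp: f_def rev_lang_iff' dfa_lang_def lists_UNIV dfa_def)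
    thus "\<And>u v. f u = f v \<Longrightarrow> u \<in> rev_lang L \<Longrightarrow> v \<in> rev_lang L" by simp
  qed
qed

lemma regular_by_rev_lang:
  assumes "regular (rev_lang L)"
  shows "regular L"
proof -
  have "rev_lang (rev_lang L) = L" by (auto simp: rev_lang_iff')
  thus ?thesis using regular_rev_lang[OF assms] by simp
qed

text \<open>A shortest word with the same target repeats no state, since otherwise a cycle could be
  cut out.\<close>

lemma short_run:
  assumes A: "dfa Sig Q q0 d F" and q: "q \<in> Q" and u: "u \<in> lists Sig"
  obtains u' where "u' \<in> lists Sig" "length u' < card Q" "run d q u' = run d q u"
proof -
  define u' where "u' = (ARG_MIN length x. x \<in> lists Sig \<and> run d q x = run d q u)"
  have u': "u' \<in> lists Sig \<and> run d q u' = run d q u"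
    unfolding u'_def by (rule arg_min_natI[of _ u]) (use u in auto)
  have le: "length u' \<le> length x" if "x \<in> lists Sig" "run d q x = run d q u" for x
    unfolding u'_def by (rule arg_min_nat_le) (use that in auto)
  have "length u' < card Q"
  proof (rule ccontr)
    assume *: "\<not> length u' < card Q"
    let ?g = "\<lambda>i. run d q (take i u')"
    have "take i u' \<in> lists Sig" for i
      using u' by (auto dest: in_set_takeD)
    hence sub: "?g ` {..length u'} \<subseteq> Q"
      using dfa_run_in[OF A q] by blast
    have fin: "finite Q" using A by (simp add: dfa_def)
    have "\<not> inj_on ?g {..length u'}"
    proof
      assume "inj_on ?g {..length u'}"
      hence "card {..length u'} \<le> card Q" using sub fin by (rule card_inj_on_le)
      thus False using * by simp
    qed
    then obtain i j where ij: "i < j" "j \<le> length u'" "?g i = ?g j"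
      unfolding inj_on_def by (metis atMost_iff linorder_neqE_nat)
    let ?x = "take i u' @ drop j u'"
    have "run d q ?x = run d q (take j u' @ drop j u')"
      by (simp only: run_append ij(3))
    hence "run d q ?x = run d q u" using u' by simp
    moreover have "?x \<in> lists Sig" using u' by (auto dest: in_set_takeD in_set_dropD)
    ultimately have "length u' \<le> length ?x" by (intro le)
    thus False using ij by simp
  qed
  thus thesis using u' that by blast
qed

section \<open>Well-behaved automata\<close>

lemma reach_refl [simp]: "reach Sig d p p"
  unfolding reach_def by (rule bexI[of _ "[]"]) auto

lemma reach_run [simp]: "reach UNIV d p (run d p u)"
  unfolding reach_def by (auto simp: lists_UNIV)

lemma reach_step [simp]: "reach UNIV d p (d p c)"
  using reach_run[of d p "[c]"] by simp

lemma reach_trans: "reach Sig d p q \<Longrightarrow> reach Sig d q r \<Longrightarrow> reach Sig d p r"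
  unfolding reach_def by (metis append_in_lists_conv run_append)

lemma reachE:
  assumes "reach Sig d p q" obtains u where "u \<in> lists Sig" "run d p u = q"
  using assms by (auto simp: reach_def)

lemma reach_in:
  assumes "dfa Sig Q q0 d F" "p \<in> Q" "reach Sig d p q" shows "q \<in> Q"
  using assms(3) dfa_run_in[OF assms(1,2)] by (auto simp: reach_def)

text \<open>A state reached from \<open>q\<close> lies in the component of \<open>q\<close> iff it
  can return to \<open>q\<close>. Components thus disappear from the condition, and later arguments
  speak of return paths only.\<close>

lemma well_behaved_dfa_iff:
  "well_behaved_dfa UNIV Q q0 d F \<longleftrightarrow> dfa UNIV Q q0 d F \<and>
     (\<forall>q u v. reach UNIV d q0 q \<longrightarrow> length u = length v \<longrightarrow>
        reach UNIV d (run d q u) q \<longrightarrow> reach UNIV d (run d q v) q \<longrightarrow>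
        (run d q u \<in> F \<longleftrightarrow> run d q v \<in> F))"
    (is "_ \<longleftrightarrow> _ \<and> ?R")
proof (intro iffI conjI)
  assume W: "well_behaved_dfa UNIV Q q0 d F"
  thus A: "dfa UNIV Q q0 d F" by (simp add: well_behaved_dfa_def)
  show ?R
  proof (intro allI impI)
    fix q u v
    assume r: "reach UNIV d q0 q" and l: "length u = length v"
      and b: "reach UNIV d (run d q u) q" "reach UNIV d (run d q v) q"
    \<comment> \<open>The component of \<open>q\<close>; its maximality holds because any mutually
      reachable superset contains \<open>q\<close>.\<close>
    let ?C = "{p. reach UNIV d q p \<and> reach UNIV d p q}"
    have "q \<in> Q" using reach_in[OF A _ r] A by (simp add: dfa_def)
    hence "?C \<subseteq> Q" using reach_in[OF A] by blast
    have "D \<subseteq> ?C" if "?C \<subseteq> D" "mutually_reachable UNIV d D" for D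
    proof
      have "q \<in> D" using that(1) by auto
      thus "p \<in> ?C" if "p \<in> D" for p
        using \<open>mutually_reachable UNIV d D\<close> that unfolding mutually_reachable_def by blast
    qed
    moreover have "mutually_reachable UNIV d ?C"
      unfolding mutually_reachable_def 
    proof (intro ballI)
      fix p p' assume "p \<in> ?C" "p' \<in> ?C"
      thus "reach UNIV d p p' \<and> reach UNIV d p' p"
        using reach_trans[of UNIV d p q p'] reach_trans[of UNIV d p' q p] by simp
    qed
    ultimately have "is_scc UNIV Q d ?C"
      using \<open>?C \<subseteq> Q\<close> unfolding is_scc_def by blast
    hence "well_behaved_scc UNIV d F ?C"
      using W r bexI[of _ q ?C] unfolding well_behaved_dfa_def by simp
    moreover have "q \<in> ?C" "run d q u \<in> ?C" "run d q v \<in> ?C" using b by auto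
    ultimately show "run d q u \<in> F \<longleftrightarrow> run d q v \<in> F"
      using l unfolding well_behaved_scc_def lists_UNIV by blast
  qed
next
  assume R: "dfa UNIV Q q0 d F \<and> ?R"
  show "well_behaved_dfa UNIV Q q0 d F"
    unfolding well_behaved_dfa_def
  proof (intro conjI allI impI)
    fix C assume C: "is_scc UNIV Q d C \<and> (\<exists>q\<in>C. reach UNIV d q0 q)"
    then obtain p where p: "p \<in> C" "reach UNIV d q0 p" by blast
    have m: "reach UNIV d q q'" if "q \<in> C" "q' \<in> C" for q q'
      using C that by (auto simp: is_scc_def mutually_reachable_def)
    show "well_behaved_scc UNIV d F C"
      unfolding well_behaved_scc_def
    proof (intro ballI impI)
      fix q u v assume "q \<in> C" "length u = length v \<and> run d q u \<in> C \<and> run d q v \<in> C"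
      thus "run d q u \<in> F \<longleftrightarrow> run d q v \<in> F"
        using R m reach_trans[OF p(2) m[OF p(1)]] by blast
    qed
  qed (use R in blast)
qed

lemma well_behaved_dfaD:
  assumes "well_behaved_dfa UNIV Q q0 d F"
    and "reach UNIV d q0 q" "length u = length v"
    and "reach UNIV d (run d q u) q" "reach UNIV d (run d q v) q"
  shows "run d q u \<in> F \<longleftrightarrow> run d q v \<in> F"
  using assms unfolding well_behaved_dfa_iff by blast

section \<open>Polynomial bounds\<close>

text \<open>A bound for all \<open>n\<close> with base \<open>n + 1\<close>, which is positive even
  at 0, is easier to combine than an asymptotic one; \<open>poly_bounded_iff_bigo\<close>
  translates.\<close>

definition poly_bounded :: "(nat \<Rightarrow> nat) \<Rightarrow> bool" where
  "poly_bounded g \<longleftrightarrow> (\<exists>c d. \<forall>n. g n \<le> c * (n + 1) ^ d)"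

lemma poly_boundedI: "(\<And>n. g n \<le> c * (n + 1) ^ d) \<Longrightarrow> poly_bounded g"
  unfolding poly_bounded_def by blast

lemma poly_bounded_mono:
  assumes "poly_bounded g" "\<And>n. f n \<le> g n"
  shows "poly_bounded f"
  using assms unfolding poly_bounded_def by (meson le_trans)

lemma poly_bounded_const: "poly_bounded (\<lambda>n. k)"
  by (rule poly_boundedI[of _ k 0]) simp

lemma poly_bounded_add_const: "poly_bounded (\<lambda>n. n + k)"
  by (rule poly_boundedI[of _ "k + 1" 1]) simp

lemma poly_bounded_add:
  assumes "poly_bounded f" "poly_bounded g"
  shows "poly_bounded (\<lambda>n. f n + g n)"
proof -
  obtain c d c' d' where "\<And>n. f n \<le> c * (n + 1) ^ d" and "\<And>n. g n \<le> c' * (n + 1) ^ d'"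
    using assms unfolding poly_bounded_def by blast
  moreover have "c * (n + 1) ^ d \<le> c * (n + 1) ^ (d + d')"
    and "c' * (n + 1) ^ d' \<le> c' * (n + 1) ^ (d + d')" for n
    by (auto intro!: power_increasing)
  ultimately have "f n + g n \<le> (c + c') * (n + 1) ^ (d + d')" for n
    by (simp only: add_mult_distrib) (meson add_mono le_trans)
  thus ?thesis by (rule poly_boundedI)
qed

lemma poly_bounded_mult:
  assumes "poly_bounded f" "poly_bounded g"
  shows "poly_bounded (\<lambda>n. f n * g n)"
proof -
  obtain c d c' d' where "\<And>n. f n \<le> c * (n + 1) ^ d" and "\<And>n. g n \<le> c' * (n + 1) ^ d'"
    using assms unfolding poly_bounded_def by blast
  hence "f n * g n \<le> (c * (n + 1) ^ d) * (c' * (n + 1) ^ d')" for n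
    by (rule mult_le_mono)
  hence "f n * g n \<le> (c * c') * (n + 1) ^ (d + d')" for n
    by (simp add: power_add ac_simps)
  thus ?thesis by (rule poly_boundedI)
qed

lemma poly_bounded_shift:
  assumes "poly_bounded g"
  shows "poly_bounded (\<lambda>n. g (n + k))"
proof -
  obtain c d where g: "\<And>n. g n \<le> c * (n + 1) ^ d"
    using assms unfolding poly_bounded_def by blast
  have "g (n + k) \<le> (c * (k + 1) ^ d) * (n + 1) ^ d" for n
  proof -
    have "n + k + 1 \<le> (k + 1) * (n + 1)" by simp
    hence "(n + k + 1) ^ d \<le> ((k + 1) * (n + 1)) ^ d" by (rule power_mono) simp
    hence "c * (n + k + 1) ^ d \<le> c * (((k + 1) * (n + 1)) ^ d)" by simp
    thus ?thesis using g[of "n + k"] by (simp only: power_mult_distrib mult.assoc)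
  qed
  thus ?thesis by (rule poly_boundedI)
qed

lemma poly_bounded_iff_bigo:
  "poly_bounded g \<longleftrightarrow> (\<exists>d. (\<lambda>n. real (g n)) \<in> O(\<lambda>n. real n ^ d))"
proof
  assume "poly_bounded g"
  then obtain c d where g: "\<And>n. g n \<le> c * (n + 1) ^ d"
    unfolding poly_bounded_def by blast
  have "real (g n) \<le> real c * 2 ^ d * real n ^ d" if "n \<ge> 1" for n
  proof -
    have "(n + 1) ^ d \<le> (2 * n) ^ d" using that by (intro power_mono) auto
    hence "g n \<le> c * (2 * n) ^ d" using g[of n] by (meson le_trans mult_le_mono2)
    hence "real (g n) \<le> real (c * (2 * n) ^ d)" by (rule of_nat_mono)
    thus ?thesis by (simp add: power_mult_distrib)
  qed
  hence "(\<lambda>n. real (g n)) \<in> O(\<lambda>n. real n ^ d)"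
    by (intro bigoI[of _ "real c * 2 ^ d"] eventually_at_top_linorderI[of 1]) auto
  thus "\<exists>d. (\<lambda>n. real (g n)) \<in> O(\<lambda>n. real n ^ d)" by blast
next
  assume "\<exists>d. (\<lambda>n. real (g n)) \<in> O(\<lambda>n. real n ^ d)"
  then obtain d C where "eventually (\<lambda>n. norm (real (g n)) \<le> C * norm (real n ^ d)) at_top"
    by (auto elim: landau_o.bigE)
  then obtain N where N: "\<And>n. n \<ge> N \<Longrightarrow> real (g n) \<le> C * real n ^ d"
    by (auto simp: eventually_at_top_linorder)
  \<comment> \<open>The sum absorbs the finitely many values below the threshold \<open>N\<close>;
    \<open>nat\<close> guards against a negative \<open>C\<close>.\<close>
  define c where "c = nat \<lceil>C\<rceil> + (\<Sum>i<N. g i)"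
  have "g n \<le> c * (n + 1) ^ d" for n
  proof (cases "n < N")
    case True
    hence "g n \<le> (\<Sum>i<N. g i)" by (intro member_le_sum) auto
    also have "\<dots> \<le> c" by (simp add: c_def)
    also have "\<dots> \<le> c * (n + 1) ^ d" by simp
    finally show ?thesis .
  next
    case False
    hence "real (g n) \<le> C * real n ^ d" by (intro N) simp
    also have "\<dots> \<le> real (nat \<lceil>C\<rceil>) * real (n + 1) ^ d"
      by (intro mult_mono power_mono) (auto simp: real_nat_ceiling_ge)
    also have "\<dots> \<le> real c * real (n + 1) ^ d"
      by (intro mult_right_mono) (auto simp: c_def sum_nonneg)
    also have "\<dots> = real (c * (n + 1) ^ d)" by simp
    finally show ?thesis by (simp only: of_nat_le_iff)
  qed
  thus "poly_bounded g" by (rule poly_boundedI)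
qed

lemma poly_growth_iff: "poly_growth L \<longleftrightarrow> poly_bounded (growth L)"
  by (simp add: poly_growth_def poly_bounded_iff_bigo)

lemma log_bigo_if_poly_bounded:
  assumes "poly_bounded (\<lambda>n. 2 ^ s n)"
  shows "(\<lambda>n. real (s n)) \<in> O(\<lambda>n. ln (real n))"
proof -
  obtain c d where s: "\<And>n. 2 ^ s n \<le> c * (n + 1) ^ d"
    using assms unfolding poly_bounded_def by blast
  have "c > 0" using s[of 0] by (cases c) auto
  have *: "real (s n) \<le> (ln (real c) + real d * ln (real n + 1)) / ln 2" for n
  proof -
    have "2 ^ s n \<le> real c * (real n + 1) ^ d"
      using of_nat_mono[OF s[of n], where 'a = real] by (simp add: add.commute)
    hence "ln (2 ^ s n) \<le> ln (real c * (real n + 1) ^ d)"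
      using \<open>c > 0\<close> by (subst ln_le_cancel_iff) auto
    also have "\<dots> = ln (real c) + real d * ln (real n + 1)"
      using \<open>c > 0\<close> by (simp add: ln_mult ln_realpow)
    finally show ?thesis by (simp add: ln_realpow field_simps)
  qed
  have "(\<lambda>n. real (s n)) \<in> O(\<lambda>n. (ln (real c) + real d * ln (real n + 1)) / ln 2)"
    by (rule landau_o.big_mono) (use * in \<open>auto intro!: always_eventually order_trans[OF _ divide_right_mono[OF abs_ge_self]]\<close>)
  also have "(\<lambda>n. (ln (real c) + real d * ln (real n + 1)) / ln 2) \<in> O(\<lambda>n. ln (real n))"
    by real_asymp
  finally show ?thesis .
qed

section \<open>Functions on words with polynomially many values\<close>

definition poly_range :: "('a::finite list \<Rightarrow> 'b) \<Rightarrow> bool" where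
  "poly_range f \<longleftrightarrow> poly_bounded (\<lambda>n. card (f ` {w. length w \<le> n}))"

lemma finite_length_le [simp]: "finite {w :: 'a::finite list. length w \<le> n}"
  using finite_lists_length_le[OF finite_UNIV, of n] by simp

lemma poly_rangeI:
  assumes "poly_bounded (\<lambda>n. card (B n))" "\<And>n. finite (B n)"
    and "\<And>w n. length w \<le> n \<Longrightarrow> f w \<in> B n"
  shows "poly_range f"
  unfolding poly_range_def
  by (rule poly_bounded_mono[OF assms(1)]) (use assms(2,3) in \<open>auto intro!: card_mono\<close>)

lemma poly_range_factor:
  assumes "poly_range f" "\<And>u v. f u = f v \<Longrightarrow> g u = g v"
  shows "poly_range g"
proof -
  have "\<forall>u v. f u = f v \<longrightarrow> g u = g v" using assms(2) by blast
  then obtain k where k: "g = k \<circ> f" unfolding function_factors_left by blast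
  have "card (g ` {w. length w \<le> n}) \<le> card (f ` {w. length w \<le> n})" for n
    unfolding k image_comp[symmetric] by (rule card_image_le) simp
  with assms(1) show ?thesis unfolding poly_range_def by (rule poly_bounded_mono)
qed

lemma poly_range_pair:
  assumes "poly_range f" "poly_range g"
  shows "poly_range (\<lambda>w. (f w, g w))"
  using poly_bounded_mult[OF assms[unfolded poly_range_def]]
  by (intro poly_rangeI[where B = "\<lambda>n. f ` {w. length w \<le> n} \<times> g ` {w. length w \<le> n}"])
    (auto simp: card_cartesian_product)

text \<open>Iterated pairing. Restriction to \<open>Q\<close> makes two tuples equal exactly when
  their components on \<open>Q\<close> agree.\<close>

lemma poly_range_restrict:
  assumes "finite Q" "\<And>q. q \<in> Q \<Longrightarrow> poly_range (h q)"
  shows "poly_range (\<lambda>w. \<lambda>q\<in>Q. h q w)"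
  using assms
proof (induction Q)
  case empty
  show ?case
    by (rule poly_rangeI[where B = "\<lambda>n. {\<lambda>q. undefined}"]) (auto intro: poly_bounded_const)
next
  case (insert p Q)
  have "poly_range (\<lambda>w. (\<lambda>q\<in>Q. h q w, h p w))"
    by (rule poly_range_pair) (use insert.IH insert.prems in blast)+
  thus ?case
  proof (rule poly_range_factor)
    fix u v assume *: "(\<lambda>q\<in>Q. h q u, h p u) = (\<lambda>q\<in>Q. h q v, h p v)"
    have "h q u = h q v" if "q \<in> Q" for q
      using that fun_cong[of "\<lambda>q\<in>Q. h q u" "\<lambda>q\<in>Q. h q v" q] * by (metis Pair_inject restrict_apply')
    with * show "(\<lambda>q\<in>insert p Q. h q u) = (\<lambda>q\<in>insert p Q. h q v)"
      by (auto intro: restrict_ext)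
  qed
qed

lemma poly_range_length: "poly_range length"
  by (rule poly_rangeI[where B = "\<lambda>n. {..n}"]) (auto intro: poly_bounded_add_const[of 1, simplified])

section \<open>Window classes\<close>

text \<open>\<open>wnd\<close> started from an arbitrary window, so that the futures of a window can
  be expressed.\<close>

definition slide :: "'a list \<Rightarrow> 'a option list \<Rightarrow> 'a list" where
  "slide v t = foldl (\<lambda>v c. case c of Some b \<Rightarrow> v @ [b] | None \<Rightarrow> tl v) v t"

lemma slide_Nil [simp]: "slide v [] = v"
  and slide_append: "slide v (s @ t) = slide (slide v s) t"
  and slide_Some [simp]: "slide v [Some b] = v @ [b]"
  and slide_None [simp]: "slide v [None] = tl v"
  by (simp_all add: slide_def)

lemma wnd_eq_slide: "wnd u = slide [] u"
  by (simp add: wnd_def slide_def)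

lemma wnd_append: "wnd (u @ t) = slide (wnd u) t"
  by (simp add: wnd_eq_slide slide_append)

lemma wnd_map_Some [simp]: "wnd (map Some w) = w"
  by (induction w rule: rev_induct) (auto simp: wnd_append, simp add: wnd_eq_slide)

text \<open>How many old letters \<open>t\<close> removes and what it leaves behind them depends on
  the window only through its length \<open>n\<close>.\<close>

lemma slide_eq_drop:
  obtains j y where "j \<le> n" "\<And>u. length u = n \<Longrightarrow> slide u t = drop j u @ y"
proof -
  have "\<exists>j y. j \<le> n \<and> (\<forall>u. length u = n \<longrightarrow> slide u t = drop j u @ y)"
  proof (induction t rule: rev_induct)
    case Nil
    show ?case by (rule exI[of _ 0], rule exI[of _ "[]"]) auto
  next
    case (snoc c t)
    then obtain j y where j: "j \<le> n" "\<And>u. length u = n \<Longrightarrow> slide u t = drop j u @ y" by blast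
    show ?case
    proof (cases c)
      case (Some b)
      with j show ?thesis
        by (intro exI[of _ j] exI[of _ "y @ [b]"]) (auto simp: slide_append)
    next
      case None
      show ?thesis
      proof (cases "j < n")
        case True
        with None j show ?thesis
          by (intro exI[of _ "Suc j"] exI[of _ y]) (auto simp: slide_append drop_Suc tl_drop)
      next
        \<comment> \<open>The original window is used up, so the pop acts on \<open>y\<close>; if
          \<open>y\<close> is empty as well, \<open>tl\<close> leaves it empty.\<close>
        case False
        with None j show ?thesis
          by (intro exI[of _ n] exI[of _ "tl y"]) (auto simp: slide_append)
      qed
    qed
  qed
  thus thesis using that by blast
qed

text \<open>The Myhill-Nerode class of a window with respect to pushes and pops.\<close>

definition wcls :: "'a list set \<Rightarrow> 'a list \<Rightarrow> 'a option list set" where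
  "wcls L w = {t. slide w t \<in> L}"

lemma wcls_slide: "wcls L (slide w s) = {t. s @ t \<in> wcls L w}"
  by (simp add: wcls_def slide_append)

text \<open>By \<open>slide_eq_drop\<close>, every future of a window is a suffix of it extended by
  some \<open>y\<close>, with the same cut and the same \<open>y\<close> for all windows of equal
  length. So a map that settles these memberships, together with the length, determines the
  class.\<close>

lemma poly_range_wclsI:
  assumes "poly_range h"
    and "\<And>u v j y. length u = length v \<Longrightarrow> j \<le> length u \<Longrightarrow> h u = h v
           \<Longrightarrow> drop j u @ y \<in> L \<Longrightarrow> drop j v @ y \<in> L"
  shows "poly_range (wcls L)"
proof (rule poly_range_factor[OF poly_range_pair[OF poly_range_length assms(1)]])
  have "wcls L u \<subseteq> wcls L v" if eq: "length u = length v" "h u = h v" for u v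
  proof
    fix t assume t: "t \<in> wcls L u"
    obtain j y where j: "j \<le> length u"
      "\<And>u'. length u' = length u \<Longrightarrow> slide u' t = drop j u' @ y"
      by (rule slide_eq_drop[where n = "length u" and t = t]) blast
    have "drop j u @ y \<in> L" using t j(2)[of u] by (simp add: wcls_def)
    hence "drop j v @ y \<in> L" by (rule assms(2)[OF eq(1) j(1) eq(2)])
    thus "t \<in> wcls L v" using j(2)[of v] eq(1) by (simp add: wcls_def)
  qed
  thus "wcls L u = wcls L v" if "(length u, h u) = (length v, h v)" for u v
    using that by (metis Pair_inject subset_antisym)
qed

lemma poly_range_wcls_Compl:
  assumes "poly_range (wcls L)"
  shows "poly_range (wcls (- L))"
proof (rule poly_range_factor[OF assms])
  have "wcls (- L) w = - wcls L w" for w by (auto simp: wcls_def)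
  thus "wcls L u = wcls L v \<Longrightarrow> wcls (- L) u = wcls (- L) v" for u v by simp
qed

lemma poly_range_wcls_Int:
  assumes "poly_range (wcls L)" "poly_range (wcls K)"
  shows "poly_range (wcls (L \<inter> K))"
proof (rule poly_range_factor[OF poly_range_pair[OF assms]])
  have "wcls (L \<inter> K) w = wcls L w \<inter> wcls K w" for w by (auto simp: wcls_def)
  thus "(wcls L u, wcls K u) = (wcls L v, wcls K v) \<Longrightarrow> wcls (L \<inter> K) u = wcls (L \<inter> K) v" for u v
    by simp
qed

section \<open>Sliding window algorithms\<close>

text \<open>Least significant bit first. Zero is the empty word, so a nonempty code ends in
  \<open>True\<close> and codes are unique.\<close>

fun bin :: "nat \<Rightarrow> bool list" where
  "bin k = (if k = 0 then [] else odd k # bin (k div 2))"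

declare bin.simps [simp del]

lemma inj_bin: "inj bin"
proof (rule injI)
  show "j = k" if "bin j = bin k" for j k
    using that
  proof (induction j arbitrary: k rule: less_induct)
    case (less j)
    show ?case
    proof (cases "j = 0 \<or> k = 0")
      case True
      thus ?thesis using less.prems bin.simps[of j] bin.simps[of k] by (auto split: if_splits)
    next
      case False
      hence *: "odd j = odd k" "bin (j div 2) = bin (k div 2)"
        using less.prems bin.simps[of j] bin.simps[of k] by auto
      have "j div 2 = k div 2" by (rule less.IH) (use False * in auto)
      with *(1) show ?thesis by (metis dvd_mult_div_cancel odd_two_times_div_two_succ)
    qed
  qed
qed

lemma length_bin: "2 ^ length (bin k) \<le> 2 * k + 1"
proof -
  have "2 ^ length (bin k) \<le> 2 * k" if "k > 0"
    using that
  proof (induction k rule: less_induct)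
    case (less k)
    have eq: "(2::nat) ^ length (bin k) = 2 * 2 ^ length (bin (k div 2))"
      using less.prems by (subst bin.simps) simp
    show ?case
    proof (cases "k = 1")
      case False
      hence "2 ^ length (bin (k div 2)) \<le> 2 * (k div 2)"
        using less.prems by (intro less.IH) auto
      moreover have "2 * (k div 2) \<le> k" by simp
      ultimately show ?thesis using eq by linarith
    qed (use bin.simps[of 0] bin.simps[of 1] in simp)
  qed
  thus ?thesis by (cases "k = 0") (auto simp: bin.simps[of 0] intro: le_SucI)
qed

lemma triangle_le: "triangle n \<le> n * n"
  by (induction n) auto

text \<open>The states are window classes; \<open>wcls_slide\<close> shows that a push or pop acts
  on them. A single encoding must be short for all window lengths at once: a class is coded by the
  least length \<open>lev\<close> of a window in it and its index among the classes up to that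
  length. Codes of classes occurring up to length \<open>n\<close> are then polynomial in
  \<open>n\<close> and have logarithmically many bits.\<close>

lemma V_logI:
  fixes L :: "'a::finite list set"
  assumes "poly_range (wcls L)"
  shows "L \<in> V_log"
proof -
  define A where "A n = wcls L ` {w. length w \<le> n}" for n
  define lev where "lev x = (LEAST n. x \<in> A n)" for x
  define e where "e x = prod_encode (lev x, to_nat_on (A (lev x)) x)" for x
  have finA: "finite (A n)" for n by (simp add: A_def)
  have A_mono: "A m \<subseteq> A n" if "m \<le> n" for m n using that by (auto simp: A_def)
  have lev: "x \<in> A (lev x)" "lev x \<le> n" if "x \<in> A n" for x n
    using that unfolding lev_def by (auto intro: LeastI Least_le)
  have inA: "wcls L w \<in> A (length w)" for w by (auto simp: A_def)
  have idx: "to_nat_on (A n) x < card (A n)" if "x \<in> A n" for x n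
    using to_nat_on_finite[OF finA[of n]] that by (auto simp: bij_betw_def)
  have e_inj: "x = y" if "e x = e y" "x \<in> A n" "y \<in> A m" for x y n m
  proof -
    have "lev x = lev y" "to_nat_on (A (lev x)) x = to_nat_on (A (lev y)) y"
      using that(1) by (auto simp: e_def)
    thus ?thesis
      using to_nat_on_finite[OF finA[of "lev x"]] lev(1)[OF that(2)] lev(1)[OF that(3)]
      by (metis bij_betw_imp_inj_on inj_onD)
  qed
  have e_le: "e x \<le> (n + card (A n) + 1) * (n + card (A n) + 1)" if x: "x \<in> A n" for x n
  proof -
    let ?i = "to_nat_on (A (lev x)) x"
    have "?i \<le> card (A n)"
      using idx[OF lev(1)[OF x]] card_mono[OF finA A_mono[OF lev(2)[OF x]]] by simp
    hence le: "lev x + ?i \<le> n + card (A n)" using lev(2)[OF x] by simp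
    \<comment> \<open>\<open>prod_encode (i, j)\<close> equals \<open>triangle (i + j) + i\<close>,
      so pairing costs only a square.\<close>
    have "e x \<le> (lev x + ?i) * (lev x + ?i) + lev x"
      by (simp add: e_def prod_encode_def triangle_le)
    also have "\<dots> \<le> (n + card (A n)) * (n + card (A n)) + (n + card (A n))"
      using le lev(2)[OF x] by (meson add_mono mult_le_mono trans_le_add1)
    finally show ?thesis by (simp add: algebra_simps)
  qed
  define h where "h u = e (wcls L (wnd u))" for u
  have h_eq: "h u = h v \<longleftrightarrow> wcls L (wnd u) = wcls L (wnd v)" for u v
    unfolding h_def using e_inj inA by metis
  have cong: "h (u @ [c]) = h (v @ [c])" if "h u = h v" for u v c
    using that unfolding h_eq wnd_append wcls_slide by simp
  have "\<exists>d. (\<forall>w\<in>lists UNIV. \<forall>c\<in>UNIV. d (h w) c = h (w @ [c]))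
      \<and> (\<forall>w\<in>lists UNIV. run d (h []) w = h w)"
    by (rule transition_exists) (rule cong)
  then obtain d where d: "\<And>w c. d (h w) c = h (w @ [c])" "\<And>w. run d (h []) w = h w"
    unfolding lists_UNIV by blast
  define B where "B = \<lparr>st = range h, init = h [], trans = d, acc = h ` {u. wnd u \<in> L}, enc = bin\<rparr>"
  define s where "s n = Max ((\<lambda>w. length (bin (e (wcls L w)))) ` {w. length w \<le> n})" for n
  have "streaming_alg B"
    using inj_on_subset[OF inj_bin] by (auto simp: streaming_alg_def B_def d(1))
  moreover have "salg_lang B = {w. wnd w \<in> L}"
  proof -
    have "wnd u \<in> L \<longleftrightarrow> [] \<in> wcls L (wnd u)" for u by (simp add: wcls_def)
    hence "h u \<in> h ` {u. wnd u \<in> L} \<longleftrightarrow> wnd u \<in> L" for u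
      using h_eq by (metis (mono_tags, lifting) image_iff mem_Collect_eq)
    thus ?thesis by (simp add: salg_lang_def B_def d(2))
  qed
  moreover have "space B u \<le> s n" if "\<forall>i\<le>length u. length (wnd (take i u)) \<le> n" for u n
    unfolding space_def
  proof (intro Max.boundedI; clarsimp)
    fix i assume "i \<le> length u"
    with that have "length (wnd (take i u)) \<le> n" by blast
    thus "length (enc B (run (trans B) (init B) (take i u))) \<le> s n"
      unfolding s_def by (intro Max_ge) (auto simp: B_def d(2) h_def[of "take i u"])
  qed
  moreover have "(\<lambda>n. real (s n)) \<in> O(\<lambda>n. ln (real n))"
  proof (rule log_bigo_if_poly_bounded, rule poly_bounded_mono)
    let ?g = "\<lambda>n. n + card (A n) + 1"
    have "poly_bounded (\<lambda>n. card (A n))" using assms by (simp add: poly_range_def A_def)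
    from poly_bounded_add[OF poly_bounded_add_const[of 1] this] have "poly_bounded ?g"
      by (simp add: add.commute add.left_commute)
    from poly_bounded_add[OF poly_bounded_mult[OF poly_bounded_const[of 2]
          poly_bounded_mult[OF this this]] poly_bounded_const[of 1]]
    show "poly_bounded (\<lambda>n. 2 * (?g n * ?g n) + 1)" .
    fix n
    have "s n \<in> (\<lambda>w. length (bin (e (wcls L w)))) ` {w. length w \<le> n}"
      unfolding s_def by (rule Max_in) (auto intro: exI[of _ "[]"])
    then obtain w where w: "length w \<le> n" "s n = length (bin (e (wcls L w)))" by blast
    have "wcls L w \<in> A n" using inA A_mono[OF w(1)] by blast
    thus "2 ^ s n \<le> 2 * (?g n * ?g n) + 1"
      unfolding w(2) using length_bin[of "e (wcls L w)"] e_le by (meson add_le_mono1 le_trans mult_le_mono2)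
  qed
  ultimately show ?thesis unfolding V_log_def V_class_def by blast
qed

lemma lastn_eq_drop: "lastn a n w = drop (length w) (replicate n a @ w)"
  by (auto simp: lastn_def)

lemma V_log_subset_F_log: "V_log \<subseteq> F_log a"
proof
  fix L :: "'a list set" assume "L \<in> V_log"
  then obtain s A where s: "(\<lambda>n. real (s n)) \<in> O(\<lambda>n. ln (real n))" and A: "streaming_alg A"
    and lang: "salg_lang A = {w. wnd w \<in> L}"
    and sp: "\<And>n u. \<forall>i\<le>length u. length (wnd (take i u)) \<le> n \<Longrightarrow> space A u \<le> s n"
    unfolding V_log_def V_class_def by blast
  let ?step = "run (trans A) (init A)"
  \<comment> \<open>The initial pushes of \<open>a\<close> realize the padding of
    \<open>lastn\<close>. Each pop precedes its push, so no intermediate window exceeds length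
    \<open>n\<close>.\<close>
  define sim where "sim n w = map Some (replicate n a) @ concat (map (\<lambda>c. [None, Some c]) w)" for n w
  have sim_Nil: "sim n [] = map Some (replicate n a)"
    and sim_snoc: "sim n (w @ [c]) = (sim n w @ [None]) @ [Some c]" for n w c
    by (simp_all add: sim_def)
  have wnd_sim: "wnd (sim n w) = lastn a n w" if "n > 0" for n w
  proof (induction w rule: rev_induct)
    case (snoc c w)
    have "tl (drop (length w) xs) @ [c] = drop (length (w @ [c])) (xs @ [c])"
      if "length w < length xs" for xs
      using that by (simp add: tl_drop drop_Suc)
    from this[of "replicate n a @ w"]
    have "tl (drop (length w) (replicate n a @ w)) @ [c]
        = drop (length (w @ [c])) (replicate n a @ (w @ [c]))"
      using that by simp
    with snoc show ?case by (simp add: sim_snoc wnd_append slide_append[of _ "[None]" "[Some c]", simplified] lastn_eq_drop del: drop_append)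
  qed (simp add: sim_Nil lastn_eq_drop del: map_replicate)
  have len_lastn: "length (lastn a n w) = n" for n w by (simp add: lastn_eq_drop)
  \<comment> \<open>The condition under which \<open>s n\<close> bounds the space; it concerns all
    prefixes, hence also the stream between a pop and its push.\<close>
  define good where "good n u \<longleftrightarrow> (\<forall>i\<le>length u. length (wnd (take i u)) \<le> n)" for n and u :: "'a option list"
  have good_snoc: "good n (u @ [c]) \<longleftrightarrow> good n u \<and> length (wnd (u @ [c])) \<le> n" for n u c
    unfolding good_def by (auto simp: le_Suc_eq)
  have good_sim: "good n (sim n w)" if "n > 0" for n w
  proof (induction w rule: rev_induct)
    case Nil
    have "length (wnd (take i (sim n []))) \<le> n" for i
      by (simp add: sim_Nil take_map del: map_replicate take_replicate)
    thus ?case by (simp add: good_def)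
  next
    case (snoc c w)
    have "length (wnd (sim n (w @ [c]))) \<le> n" "length (wnd (sim n w @ [None])) \<le> n"
      using that len_lastn[of n] wnd_sim[OF that] by (simp_all add: wnd_append)
    with snoc show ?case unfolding sim_snoc good_snoc by blast
  qed
  txt \<open>Size 0 is separate: a pop on the empty window is void, so the simulated window would grow to 1.\<close>
  define B where "B n = (if n = 0
      then \<lparr>st = {0}, init = 0, trans = \<lambda>_ _. 0, acc = (if [] \<in> L then {0} else {}), enc = \<lambda>_. []\<rparr>
      else \<lparr>st = range (\<lambda>w. ?step (sim n w)), init = ?step (sim n []),
            trans = \<lambda>q c. trans A (trans A q None) (Some c),
            acc = acc A \<inter> range (\<lambda>w. ?step (sim n w)), enc = enc A\<rparr>)" for n
  have B: "streaming_alg (B n) \<and> salg_lang (B n) = {w. lastn a n w \<in> L}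
     \<and> (\<forall>q\<in>st (B n). length (enc (B n) q) \<le> s n)" for n
  proof (cases "n = 0")
    case True
    have "run (\<lambda>_ _. 0) 0 w = (0::nat)" for w :: "'a list" by (induction w) auto
    moreover have "lastn a 0 w = []" for w by (simp add: lastn_def)
    ultimately show ?thesis using True by (auto simp: B_def streaming_alg_def salg_lang_def)
  next
    case False
    have step: "trans A (trans A (?step (sim n w)) None) (Some c) = ?step (sim n (w @ [c]))" for w c
      by (simp add: sim_snoc)
    have st: "?step u \<in> st A" for u
      by (induction u rule: rev_induct) (use A in \<open>auto simp: streaming_alg_def\<close>)
    hence "inj_on (enc A) (range (\<lambda>w. ?step (sim n w)))"
      using A by (auto simp: streaming_alg_def elim: inj_on_subset)
    hence "streaming_alg (B n)"
      using False by (auto simp: streaming_alg_def B_def step)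
    moreover have "run (trans (B n)) (init (B n)) w = ?step (sim n w)" for w
      using False by (induction w rule: rev_induct) (auto simp: B_def step)
    hence "salg_lang (B n) = {w. lastn a n w \<in> L}"
      using False lang wnd_sim[of n] by (auto simp: salg_lang_def B_def set_eq_iff)
    \<comment> \<open>\<open>F_class\<close> bounds every state, and the states of
      \<open>B n\<close> are exactly those reached by simulated streams.\<close>
    moreover have "length (enc A (?step (sim n w))) \<le> s n" for w
    proof -
      have "length (enc A (?step (sim n w))) \<le> space A (sim n w)"
        unfolding space_def by (intro Max_ge) (auto intro!: image_eqI[of _ _ "length (sim n w)"])
      also have "\<dots> \<le> s n" using good_sim[of n w] False by (intro sp) (auto simp: good_def)
      finally show ?thesis .
    qed
    hence "\<forall>q\<in>st (B n). length (enc (B n) q) \<le> s n" using False by (auto simp: B_def)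
    ultimately show ?thesis by blast
  qed
  show "L \<in> F_log a"
    unfolding F_log_def F_class_def using s B by blast
qed

section \<open>The lower bound\<close>

lemma card_bool_lists_le: "card {x :: bool list. length x \<le> n} < 2 ^ (n + 1)"
proof -
  have "card {x :: bool list. length x \<le> n} = (\<Sum>i\<le>n. 2 ^ i)"
    using card_lists_length_le[of "UNIV :: bool set" n] by (simp add: card_UNIV_bool)
  also have "\<dots> < 2 ^ (n + 1)" by (induction n) auto
  finally show ?thesis .
qed

lemma streaming_alg_run_in:
  assumes "streaming_alg A"
  shows "run (trans A) (init A) u \<in> st A"
  by (induction u rule: rev_induct) (use assms in \<open>auto simp: streaming_alg_def\<close>)

lemma rev_lastn: "n \<le> length w \<Longrightarrow> rev (lastn a n w) = take n (rev w)"
  by (simp add: lastn_def rev_drop)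

text \<open>Otherwise \<open>k\<close> would be bounded by a logarithm of an affine function of
  \<open>k\<close>. The lower bound needs more than \<open>k\<close> bits for windows of length
  \<open>l + m * k\<close>.\<close>

lemma sublinear_of_log:
  assumes s: "(\<lambda>n. real (s n)) \<in> O(\<lambda>n. ln (real n))" and m: "m > 0"
  obtains k where "s (l + m * k) < k"
proof (rule ccontr)
  assume "\<not> thesis"
  with that have le: "k \<le> s (l + m * k)" for k by (meson not_le)
  have "filterlim (\<lambda>k. l + m * k) at_top at_top"
    by (rule filterlim_at_top_mono[OF filterlim_ident]) (use m in \<open>auto intro!: always_eventually trans_le_add2\<close>)
  from landau_o.big.compose[OF s this]
  have "(\<lambda>k. real (s (l + m * k))) \<in> O(\<lambda>k. ln (real (l + m * k)))" by simp
  hence "(\<lambda>k. real k) \<in> O(\<lambda>k. ln (real (l + m * k)))"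
    by (rule landau_o.big.trans[OF landau_o.big_mono, rotated]) (use le in \<open>auto intro!: always_eventually\<close>)
  also have "(\<lambda>k. ln (real (l + m * k))) \<in> o(\<lambda>k. real k)"
  proof -
    have "real m > 0" using m by simp
    hence "(\<lambda>k. ln (real l + real m * real k)) \<in> o(\<lambda>k. real k)" by real_asymp
    thus ?thesis by simp
  qed
  finally have "(\<lambda>k. real k) \<in> o(\<lambda>k. real k)" .
  hence "eventually (\<lambda>k. real k = 0) at_top" unfolding landau_o.small_refl_iff .
  moreover have "eventually (\<lambda>k::nat. k > 0) at_top" by (rule eventually_gt_at_top)
  ultimately have "eventually (\<lambda>k::nat. False) at_top" by eventually_elim auto
  thus False by simp
qed

lemma F_log_imp_well_behaved:
  fixes L :: "'a list set"
  assumes "L \<in> F_log a" and A: "dfa UNIV Q q0 d F" and LA: "rev_lang L = dfa_lang UNIV q0 d F"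
  shows "well_behaved_dfa UNIV Q q0 d F"
  unfolding well_behaved_dfa_iff
proof (rule conjI[OF A], rule ccontr)
  assume "\<not> (\<forall>q u v. reach UNIV d q0 q \<longrightarrow> length u = length v \<longrightarrow> reach UNIV d (run d q u) q
      \<longrightarrow> reach UNIV d (run d q v) q \<longrightarrow> (run d q u \<in> F) = (run d q v \<in> F))"
  then obtain q u v where q: "reach UNIV d q0 q" and len: "length u = length v"
    and "reach UNIV d (run d q u) q" "reach UNIV d (run d q v) q"
    and diff: "(run d q u \<in> F) \<noteq> (run d q v \<in> F)"
    by blast
  then obtain r1 r2 where r: "run d (run d q u) r1 = q" "run d (run d q v) r2 = q"
    by (auto elim!: reachE)
  obtain z where z: "run d q0 z = q" using q by (auto elim: reachE)
  txt \<open>Two loops at \<open>q\<close> of equal length that start with \<open>u\<close> and \<open>v\<close>, respectively.\<close>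
  define X Y where "X = u @ r1 @ v @ r2" and "Y = v @ r2 @ u @ r1"
  define m where "m = length X"
  define blk where "blk b = (if b then X else Y)" for b
  define W where "W bs = concat (map blk bs)" for bs
  have blk: "length (blk b) = m" "run d q (blk b) = q"
    "take (length u) (blk b) = (if b then u else v)" for b
    using r len by (auto simp: blk_def X_def Y_def m_def)
  have "u \<noteq> v" using diff by auto
  \<comment> \<open>Distinct words of equal length are nonempty.\<close>
  hence m: "m > 0" using len by (auto simp: m_def X_def)
  have len_W: "length (W bs) = m * length bs" for bs
    by (induction bs) (auto simp: W_def blk)
  have run_W: "run d q (W bs) = q" for bs
    by (induction bs) (auto simp: W_def blk)
  obtain s B where s: "(\<lambda>n. real (s n)) \<in> O(\<lambda>n. ln (real n))"
    and B: "\<And>n. streaming_alg (B n)" and lang: "\<And>n. salg_lang (B n) = {w. lastn a n w \<in> L}"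
    and sp: "\<And>n q. q \<in> st (B n) \<Longrightarrow> length (enc (B n) q) \<le> s n"
    using assms(1) unfolding F_log_def F_class_def by blast
  have L_iff: "w \<in> L \<longleftrightarrow> run d q0 (rev w) \<in> F" for w
    using LA rev_lang_iff[of w L] by (simp add: dfa_lang_def lists_UNIV)
  have lower: "k < s (length z + length u + m * k)" for k
  proof -
    \<comment> \<open>In reversed order such a window consists of \<open>z\<close>, leading to
      \<open>q\<close>, then \<open>k\<close> whole blocks returning to \<open>q\<close>, then just
      the first \<open>length u\<close> letters of another block, which are \<open>u\<close> or
      \<open>v\<close>.\<close>
    define n where "n = length z + length u + m * k"
    define g where "g bs = run (trans (B n)) (init (B n)) (rev (W bs))" for bs
    have "inj_on (\<lambda>bs. enc (B n) (g bs)) {bs. length bs = Suc k}"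
    proof (rule inj_onI, rule ccontr, clarsimp)
      fix bs bs' assume l: "length bs = Suc k" "length bs' = Suc k" and "bs \<noteq> bs'"
        and eq: "enc (B n) (g bs) = enc (B n) (g bs')"
      then obtain i where i: "i < Suc k" "bs ! i \<noteq> bs' ! i" by (auto simp: list_eq_iff_nth_eq)
      \<comment> \<open>The \<open>k - i\<close> additional blocks move block \<open>i\<close> to
        the old end of the window, where only its first \<open>length u\<close> letters remain and
        decide membership.\<close>
      define t where "t = rev (z @ W (replicate (k - i) True))"
      have acc: "run (trans (B n)) (g cs) t \<in> acc (B n) \<longleftrightarrow> run d q (if cs ! i then u else v) \<in> F"
        if cs: "length cs = Suc k" for cs
      proof -
        have "cs = take i cs @ cs ! i # drop (Suc i) cs"
          using i(1) cs by (simp add: id_take_nth_drop)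
        hence Wcs: "W cs = W (take i cs) @ blk (cs ! i) @ W (drop (Suc i) cs)"
          unfolding W_def by (metis concat.simps(2) concat_append list.simps(9) map_append)
        let ?pre = "z @ W (replicate (k - i) True) @ W (take i cs)"
        have len_pre: "length ?pre = length z + m * k"
          using i(1) cs by (simp add: len_W flip: add_mult_distrib2)
        have n: "n = length ?pre + length u" unfolding len_pre n_def by simp
        let ?w = "rev (W cs) @ t"
        have "rev ?w = ?pre @ blk (cs ! i) @ W (drop (Suc i) cs)" by (simp add: t_def Wcs)
        moreover have "length u \<le> length (blk (cs ! i))" by (simp add: blk(1) m_def X_def)
        ultimately have tk: "take n (rev ?w) = ?pre @ (if cs ! i then u else v)"
          and "n \<le> length (rev ?w)"
          unfolding n using blk(3)[of "cs ! i"] by simp_all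
        hence "lastn a n ?w \<in> L \<longleftrightarrow> run d q0 (?pre @ (if cs ! i then u else v)) \<in> F"
          unfolding L_iff by (simp add: rev_lastn)
        moreover have "run d q0 ?pre = q" by (simp add: z run_W)
        ultimately have "lastn a n ?w \<in> L \<longleftrightarrow> run d q (if cs ! i then u else v) \<in> F"
          by (simp only: run_append[of d q0 ?pre])
        moreover have "lastn a n ?w \<in> L \<longleftrightarrow> run (trans (B n)) (g cs) t \<in> acc (B n)"
        proof -
          have "?w \<in> salg_lang (B n) \<longleftrightarrow> lastn a n ?w \<in> L" unfolding lang by simp
          thus ?thesis by (simp add: salg_lang_def g_def)
        qed
        ultimately show ?thesis by simp
      qed
      have "g cs \<in> st (B n)" for cs
        unfolding g_def by (rule streaming_alg_run_in[OF B])
      hence "g bs = g bs'"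
        using B[of n] eq unfolding streaming_alg_def by (meson inj_onD)
      thus False using acc[OF l(1)] acc[OF l(2)] i(2) diff by (auto split: if_splits)
    qed
    moreover have "(\<lambda>bs. enc (B n) (g bs)) ` {bs. length bs = Suc k} \<subseteq> {x. length x \<le> s n}"
      using sp streaming_alg_run_in[OF B] by (auto simp: g_def)
    ultimately have "card {bs :: bool list. length bs = Suc k} \<le> card {x :: bool list. length x \<le> s n}"
      by (rule card_inj_on_le) simp
    also have "card {bs :: bool list. length bs = Suc k} = 2 ^ Suc k"
      using card_lists_length_eq[of "UNIV :: bool set" "Suc k"] by (simp add: card_UNIV_bool)
    finally have "(2::nat) ^ Suc k < 2 ^ (s n + 1)"
      using card_bool_lists_le[of "s n"] by (rule le_less_trans)
    hence "Suc k < s n + 1" by (simp only: power_strict_increasing_iff)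
    thus ?thesis by (simp add: n_def)
  qed
  obtain k where "s (length z + length u + m * k) < k" by (rule sublinear_of_log[OF s m])
  thus False using lower[of k] by simp
qed

section \<open>Transductions\<close>

lemma length_mealy_out [simp]: "length (mealy_out \<delta> p u) = length u"
  by (induction u arbitrary: p) auto

lemma length_left_transduction [simp]: "length (left_transduction \<delta> p u) = length u"
  by (simp add: left_transduction_def)

lemma mealy_out_in_lists:
  assumes "mealy Q Gam q0 \<delta>" "p \<in> Q"
  shows "mealy_out \<delta> p u \<in> lists Gam"
  using assms(2) by (induction u arbitrary: p) (use assms(1) in \<open>auto simp: mealy_def\<close>)

text \<open>A subset construction on pairs of a Mealy state and a state of a DFA for the reversal.
  Since the output is reversed, appending a symbol to it adds a first transition, so the sets
  \<open>f y\<close> evolve by preimages.\<close>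

lemma regular_left_transduction:
  assumes M: "mealy Q Gam q0 \<delta>" and "regular L"
  shows "regular_on Gam (left_transduction \<delta> q0 ` L)"
proof -
  obtain P p0 d F where A: "dfa UNIV P p0 d F" "rev_lang L = dfa_lang UNIV p0 d F"
    using regular_rev_lang[OF assms(2)] by (auto simp: regular_on_def)
  have L_iff: "x \<in> L \<longleftrightarrow> run d p0 (rev x) \<in> F" for x
    using A(2) rev_lang_iff[of x L] by (simp add: dfa_lang_def lists_UNIV)
  define f where "f y = {(m, p) \<in> Q \<times> P. \<exists>v. rev (mealy_out \<delta> m v) = y \<and> run d p v \<in> F}" for y
  have f_snoc: "f (y @ [c]) = {(m, p) \<in> Q \<times> P. \<exists>b. snd (\<delta> m b) = c \<and> (fst (\<delta> m b), d p b) \<in> f y}" for y c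
  proof -
    have "(\<exists>v. rev (mealy_out \<delta> m v) = y @ [c] \<and> run d p v \<in> F) \<longleftrightarrow>
        (\<exists>b. snd (\<delta> m b) = c \<and> (fst (\<delta> m b), d p b) \<in> f y)" (is "?l \<longleftrightarrow> ?r")
      if mp: "m \<in> Q" "p \<in> P" for m p
    proof
      assume ?l
      then obtain v where v: "rev (mealy_out \<delta> m v) = y @ [c]" "run d p v \<in> F" by blast
      then obtain b v' where "v = b # v'" by (cases v) auto
      thus ?r using v mp M A(1) by (auto simp: f_def mealy_def dfa_def)
    next
      assume ?r
      then obtain b v where "snd (\<delta> m b) = c" "rev (mealy_out \<delta> (fst (\<delta> m b)) v) = y"
        "run d (d p b) v \<in> F" by (auto simp: f_def)
      thus ?l by (intro exI[of _ "b # v"]) auto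
    qed
    thus ?thesis unfolding f_def[of "y @ [c]"] by blast
  qed
  show ?thesis
  proof (rule regular_onI[of f])
    have "f ` lists Gam \<subseteq> Pow (Q \<times> P)" by (auto simp: f_def)
    thus "finite (f ` lists Gam)"
      using M A(1) by (auto simp: mealy_def dfa_def intro: finite_subset)
    show "left_transduction \<delta> q0 ` L \<subseteq> lists Gam"
      using mealy_out_in_lists[OF M] M by (fastforce simp: left_transduction_def mealy_def)
    show "f (u @ [c]) = f (v @ [c])" if "f u = f v" for u v c
      unfolding f_snoc that by (rule refl)
    have "y \<in> left_transduction \<delta> q0 ` L \<longleftrightarrow> (q0, p0) \<in> f y" for y
    proof -
      have "y \<in> left_transduction \<delta> q0 ` L \<longleftrightarrow>
          (\<exists>x. rev (mealy_out \<delta> q0 (rev x)) = y \<and> run d p0 (rev x) \<in> F)"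
        by (auto simp: left_transduction_def L_iff image_iff)
      also have "\<dots> \<longleftrightarrow> (\<exists>v. rev (mealy_out \<delta> q0 v) = y \<and> run d p0 v \<in> F)"
        by (metis rev_rev_ident)
      also have "\<dots> \<longleftrightarrow> (q0, p0) \<in> f y"
        using M A(1) by (auto simp: f_def mealy_def dfa_def)
      finally show ?thesis .
    qed
    thus "\<And>u v. f u = f v \<Longrightarrow> u \<in> left_transduction \<delta> q0 ` L \<Longrightarrow> v \<in> left_transduction \<delta> q0 ` L"
      by simp
  qed
qed

text \<open>A block may have length zero, so for nonempty \<open>G\<close> these are the words over
  \<open>G\<close> with at most \<open>k\<close> maximal runs.\<close>

primrec blocks :: "'b set \<Rightarrow> nat \<Rightarrow> 'b list set" where
  "blocks G 0 = {[]}"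
| "blocks G (Suc k) = {replicate l e @ y | l e y. e \<in> G \<and> y \<in> blocks G k}"

lemma blocks_SucI: "e \<in> G \<Longrightarrow> y \<in> blocks G k \<Longrightarrow> replicate l e @ y \<in> blocks G (Suc k)"
  by auto

lemma blocks_mono:
  assumes "e \<in> G" "j \<le> k"
  shows "blocks G j \<subseteq> blocks G k"
  using assms(2)
proof (induction k rule: dec_induct)
  case (step k)
  have "blocks G k \<subseteq> blocks G (Suc k)"
    using blocks_SucI[OF assms(1), of _ k 0] by auto
  with step.IH show ?case by blast
qed simp

text \<open>In words of length at most \<open>n\<close>, each block is given by a length and a
  symbol, contributing a factor \<open>(n + 1) * card G\<close>.\<close>

lemma poly_bounded_blocks:
  assumes "finite G"
  shows "finite {y \<in> blocks G k. length y \<le> n}"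
    and "poly_bounded (\<lambda>n. card {y \<in> blocks G k. length y \<le> n})"
proof (induction k arbitrary: n)
  case 0
  have "{y \<in> blocks G 0. length y \<le> n} = {[]}" for n by auto
  note * = this
  {
    case 1
    show ?case by (simp only: *) simp
  next
    case 2
    show ?case by (simp only: *) (rule poly_bounded_const)
  }
next
  case (Suc k)
  let ?S = "\<lambda>n. {y \<in> blocks G k. length y \<le> n}"
  let ?f = "\<lambda>((l, e), y). replicate l e @ y"
  have sub: "{y \<in> blocks G (Suc k). length y \<le> n} \<subseteq> ?f ` (({..n} \<times> G) \<times> ?S n)" for n
  proof
    fix x assume "x \<in> {y \<in> blocks G (Suc k). length y \<le> n}"
    then obtain l e y where "x = replicate l e @ y" "e \<in> G" "y \<in> blocks G k" "l + length y \<le> n"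
      by auto
    thus "x \<in> ?f ` (({..n} \<times> G) \<times> ?S n)" by (intro image_eqI[of _ _ "((l, e), y)"]) auto
  qed
  have fin: "finite (({..n} \<times> G) \<times> ?S n)" for n using assms Suc.IH(1) by blast
  {
    case 1
    show ?case by (rule finite_subset[OF sub]) (use fin in blast)
  next
    case 2
    have "card {y \<in> blocks G (Suc k). length y \<le> n} \<le> ((n + 1) * card G) * card (?S n)" for n
    proof -
      have "card {y \<in> blocks G (Suc k). length y \<le> n} \<le> card (({..n} \<times> G) \<times> ?S n)"
        by (rule surj_card_le[OF fin sub])
      thus ?thesis by (simp add: card_cartesian_product)
    qed
    thus ?case
      using poly_bounded_mult[OF poly_bounded_mult[OF poly_bounded_add_const poly_bounded_const] Suc.IH(2)]
      by (rule poly_bounded_mono[rotated])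
  }
qed

text \<open>The state is the current state of the automaton together with the state in which its
  strongly connected component was entered; the latter is also the output. The output word is thus
  a run-length encoding of the path summary.\<close>

definition summary :: "(nat \<Rightarrow> 'a \<Rightarrow> nat) \<Rightarrow> nat \<Rightarrow> 'a \<Rightarrow> nat \<times> nat" where
  "summary d n b = (let (p, e) = prod_decode n; p' = d p b; e' = (if reach UNIV d p' e then e else p')
     in (prod_encode (p', e'), e'))"

lemma summary_encode:
  "summary d (prod_encode (p, e)) b =
     (if reach UNIV d (d p b) e then (prod_encode (d p b, e), e) else (prod_encode (d p b, d p b), d p b))"
  by (simp add: summary_def Let_def)

lemma mealy_summary:
  assumes "dfa UNIV Q q0 d F"
  shows "mealy (prod_encode ` (Q \<times> Q)) Q (prod_encode (q0, q0)) (summary d)"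
  using assms by (auto simp: mealy_def dfa_def summary_encode)

text \<open>Invariant: both runs entered their current component at the same \<open>e\<close> and
  equally long ago, which is what well-behavedness requires at the end. When a component is left,
  the output is the new state itself, so the runs meet there and the invariant restarts with empty
  words.\<close>

lemma summary_sound:
  assumes W: "well_behaved_dfa UNIV Q q0 d F"
    and "reach UNIV d q0 e" "length x = length x'"
    and "reach UNIV d (run d e x) e" "reach UNIV d (run d e x') e"
    and "mealy_out (summary d) (prod_encode (run d e x, e)) v
       = mealy_out (summary d) (prod_encode (run d e x', e)) v'"
  shows "run d e (x @ v) \<in> F \<longleftrightarrow> run d e (x' @ v') \<in> F"
  using assms(2-)
proof (induction v arbitrary: e x x' v')
  case Nil
  hence "v' = []" by (metis length_0_conv length_mealy_out)
  with well_behaved_dfaD[OF W Nil(1-4)] show ?case by simp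
next
  case (Cons b v)
  then obtain b' w where v': "v' = b' # w" by (cases v') auto
  let ?p = "d (run d e x) b" and ?p' = "d (run d e x') b'"
  note eq = Cons.prems(5)[unfolded v' mealy_out.simps summary_encode]
  show ?case
  proof (cases "reach UNIV d ?p e")
    case True
    \<comment> \<open>A new entry state cannot return to \<open>e\<close> and hence differs from
      \<open>e\<close>. So the output symbol reveals whether the component was left.\<close>
    with eq have p': "reach UNIV d ?p' e" by (auto split: if_splits)
    have "run d e ((x @ [b]) @ v) \<in> F \<longleftrightarrow> run d e ((x' @ [b']) @ w) \<in> F"
      by (rule Cons.IH) (use Cons.prems True p' eq in auto)
    thus ?thesis by (simp add: v')
  next
    case False
    with eq have p': "?p' = ?p" by (auto split: if_splits)
    have "reach UNIV d q0 ?p"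
      using Cons.prems(1) by (meson reach_run reach_step reach_trans)
    hence "run d ?p ([] @ v) \<in> F \<longleftrightarrow> run d ?p ([] @ w) \<in> F"
      by (rule Cons.IH) (use False p' eq in auto)
    thus ?thesis by (simp add: v' p')
  qed
qed

text \<open>After the leading run of \<open>e\<close>, each new block starts where a component is
  left, which strictly shrinks the set of reachable states.\<close>

lemma summary_blocks:
  assumes A: "dfa UNIV Q q0 d F" and "e \<in> Q" "reach UNIV d e p"
  shows "\<exists>l y. mealy_out (summary d) (prod_encode (p, e)) v = replicate l e @ y
           \<and> y \<in> blocks Q (card {q. reach UNIV d e q})"
  using assms(2-)
proof (induction v arbitrary: e p)
  case Nil
  have "[] \<in> blocks Q k" for k using blocks_mono[OF Nil(1), of 0 k] by auto
  thus ?case by (intro exI[of _ 0] exI[of _ "[]"]) auto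
next
  case (Cons b v)
  let ?p = "d p b"
  have ep: "reach UNIV d e ?p" by (rule reach_trans[OF Cons.prems(2) reach_step])
  show ?case
  proof (cases "reach UNIV d ?p e")
    case True
    obtain l y where "mealy_out (summary d) (prod_encode (?p, e)) v = replicate l e @ y"
      "y \<in> blocks Q (card {q. reach UNIV d e q})"
      using Cons.IH[OF Cons.prems(1) ep] by blast
    thus ?thesis using True
      by (intro exI[of _ "Suc l"] exI[of _ y]) (auto simp: summary_encode)
  next
    case False
    have pQ: "?p \<in> Q" by (rule reach_in[OF A Cons.prems(1) ep])
    obtain l y where y: "mealy_out (summary d) (prod_encode (?p, ?p)) v = replicate l ?p @ y"
      "y \<in> blocks Q (card {q. reach UNIV d ?p q})"
      using Cons.IH[OF pQ reach_refl] by blast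
    have "{q. reach UNIV d e q} \<subseteq> Q" using reach_in[OF A Cons.prems(1)] by blast
    hence "finite {q. reach UNIV d e q}" using A by (auto simp: dfa_def intro: finite_subset)
    moreover have "{q. reach UNIV d ?p q} \<subset> {q. reach UNIV d e q}"
    proof (rule psubsetI)
      show "{q. reach UNIV d ?p q} \<subseteq> {q. reach UNIV d e q}" using reach_trans[OF ep] by blast
      have "e \<in> {q. reach UNIV d e q}" "e \<notin> {q. reach UNIV d ?p q}" using False by simp_all
      thus "{q. reach UNIV d ?p q} \<noteq> {q. reach UNIV d e q}" by metis
    qed
    ultimately have "card {q. reach UNIV d ?p q} < card {q. reach UNIV d e q}"
      by (rule psubset_card_mono)
    hence "replicate (Suc l) ?p @ y \<in> blocks Q (card {q. reach UNIV d e q})"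
      using blocks_mono[OF pQ Suc_leI] blocks_SucI[OF pQ y(2)] by blast
    thus ?thesis using False y(1)
      by (intro exI[of _ 0] exI[of _ "replicate (Suc l) ?p @ y"]) (auto simp: summary_encode)
  qed
qed

text \<open>The target language is the image of \<open>L\<close> itself. This is a reduction
  because, by \<open>summary_sound\<close>, words with equal output agree on membership in
  \<open>L\<close>.\<close>

lemma well_behaved_imp_left_reducible:
  fixes L :: "'a list set"
  assumes "regular L" and W: "well_behaved_dfa UNIV Q q0 d F"
    and LA: "rev_lang L = dfa_lang UNIV q0 d F"
  shows "left_reducible_to_regular_poly L"
proof -
  have A: "dfa UNIV Q q0 d F" using W by (simp add: well_behaved_dfa_def)
  hence Q: "finite Q" "q0 \<in> Q" by (auto simp: dfa_def)
  have L_iff: "w \<in> L \<longleftrightarrow> run d q0 (rev w) \<in> F" for w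
    using LA rev_lang_iff[of w L] by (simp add: dfa_lang_def lists_UNIV)
  define i where "i = prod_encode (q0, q0)"
  define T where "T = left_transduction (summary d) i"
  have M: "mealy (prod_encode ` (Q \<times> Q)) Q i (summary d)"
    unfolding i_def by (rule mealy_summary[OF A])
  have reg: "regular_on Q (T ` L)"
    unfolding T_def by (rule regular_left_transduction[OF M assms(1)])
  \<comment> \<open>The additional block is the leading run of \<open>q0\<close>.\<close>
  define k where "k = Suc (card {q. reach UNIV d q0 q})"
  have T: "rev (T x) \<in> blocks Q k" for x
    using summary_blocks[OF A Q(2) reach_refl, of "rev x"] Q(2)
    by (auto simp: T_def left_transduction_def i_def k_def)
  have "poly_bounded (growth (T ` L))"
  proof (rule poly_bounded_mono[OF poly_bounded_blocks(2)[OF Q(1), of k]])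
    fix n
    show "growth (T ` L) n \<le> card {y \<in> blocks Q k. length y \<le> n}"
      unfolding growth_def
      by (rule card_inj_on_le[of rev]) (use T poly_bounded_blocks(1)[OF Q(1)] in auto)
  qed
  moreover have "x \<in> L \<longleftrightarrow> T x \<in> T ` L" for x
  proof
    assume "T x \<in> T ` L"
    then obtain y where y: "y \<in> L" "T x = T y" by blast
    hence "run d q0 ([] @ rev x) \<in> F \<longleftrightarrow> run d q0 ([] @ rev y) \<in> F"
      by (intro summary_sound[OF W]) (auto simp: T_def left_transduction_def i_def)
    with y(1) show "x \<in> L" by (simp add: L_iff)
  qed simp
  moreover have "T ` L \<subseteq> lists Q" using reg by (auto simp: regular_on_def dfa_lang_def)
  ultimately show ?thesis
    unfolding left_reducible_to_regular_poly_def poly_growth_iff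
    using Q(1) M reg unfolding T_def by blast
qed

section \<open>From reductions to polynomially many window classes\<close>

lemma mealy_out_append:
  "mealy_out \<delta> p (u @ v) = mealy_out \<delta> p u @ mealy_out \<delta> (run (\<lambda>q b. fst (\<delta> q b)) p u) v"
  by (induction u arbitrary: p) auto

lemma left_transduction_append:
  "left_transduction \<delta> p (x @ y) =
     left_transduction \<delta> (run (\<lambda>q b. fst (\<delta> q b)) p (rev y)) x @ left_transduction \<delta> p y"
  by (simp add: left_transduction_def mealy_out_append)

text \<open>The machine reads from the right, so the output on a suffix does not depend on the
  letters before it.\<close>

lemma left_transduction_drop:
  "left_transduction \<delta> p (drop j u) = drop j (left_transduction \<delta> p u)"
proof (cases "j \<le> length u")
  case True
  have "left_transduction \<delta> p (take j u @ drop j u) =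
      left_transduction \<delta> (run (\<lambda>q b. fst (\<delta> q b)) p (rev (drop j u))) (take j u)
      @ left_transduction \<delta> p (drop j u)"
    by (rule left_transduction_append)
  thus ?thesis using True by simp
qed (simp add: left_transduction_def)

definition factors :: "'b list set \<Rightarrow> 'b list set" where
  "factors L = {y. \<exists>x z. x @ y @ z \<in> L}"

text \<open>The context of a factor can be replaced by words shorter than the number
  \<open>K\<close> of states. Thus a factor of length at most \<open>n\<close> is cut out of a word
  of \<open>L\<close> of length at most \<open>n + 2 * K\<close>, at a position at most
  \<open>K\<close>.\<close>

lemma poly_bounded_factors:
  assumes fin: "finite Gam" and reg: "regular_on Gam L" and poly: "poly_growth L"
  shows "finite {y \<in> factors L. length y \<le> n}"
    and "poly_bounded (\<lambda>n. card {y \<in> factors L. length y \<le> n})"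
proof -
  obtain P p0 d F where A: "dfa Gam P p0 d F" and L: "L = dfa_lang Gam p0 d F"
    using reg by (auto simp: regular_on_def)
  define K where "K = card P"
  let ?S = "\<lambda>n. {w \<in> L. length w \<le> n + 2 * K}"
  let ?D = "\<lambda>n. ({..K} \<times> {..n}) \<times> ?S n"
  let ?f = "\<lambda>((i, j), w). take j (drop i w)"
  have sub: "{y \<in> factors L. length y \<le> n} \<subseteq> ?f ` ?D n" for n
  proof
    fix y assume "y \<in> {y \<in> factors L. length y \<le> n}"
    then obtain x z where xyz: "x @ y @ z \<in> L" and n: "length y \<le> n" by (auto simp: factors_def)
    hence in_Gam: "x \<in> lists Gam" "y \<in> lists Gam" "z \<in> lists Gam"
      and acc: "run d (run d (run d p0 x) y) z \<in> F"
      by (auto simp: L dfa_lang_def)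
    have p0: "p0 \<in> P" using A by (simp add: dfa_def)
    have p1: "run d (run d p0 x) y \<in> P" using in_Gam p0 dfa_run_in[OF A] by blast
    obtain x' where x': "x' \<in> lists Gam" "length x' < K" "run d p0 x' = run d p0 x"
      using short_run[OF A p0 in_Gam(1)] by (metis K_def)
    obtain z' where z': "z' \<in> lists Gam" "length z' < K"
      "run d (run d (run d p0 x) y) z' = run d (run d (run d p0 x) y) z"
      using short_run[OF A p1 in_Gam(3)] by (metis K_def)
    have "x' @ y @ z' \<in> L"
      using x' z' in_Gam(2) acc by (auto simp: L dfa_lang_def)
    hence "((length x', length y), x' @ y @ z') \<in> ?D n" using x'(2) z'(2) n by auto
    moreover have "y = ?f ((length x', length y), x' @ y @ z')" by simp
    ultimately show "y \<in> ?f ` ?D n" by (rule rev_image_eqI)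
  qed
  have "?S n \<subseteq> {w. set w \<subseteq> Gam \<and> length w \<le> n + 2 * K}" for n
    by (auto simp: L dfa_lang_def)
  hence "finite (?S n)" for n
    using finite_lists_length_le[OF fin] by (rule finite_subset)
  hence finD: "finite (?D n)" for n by blast
  show "finite {y \<in> factors L. length y \<le> n}" by (rule finite_subset[OF sub]) (use finD in blast)
  have "card {y \<in> factors L. length y \<le> n} \<le> ((K + 1) * (n + 1)) * growth L (n + 2 * K)" for n
    using surj_card_le[OF finD sub, of n] by (simp add: card_cartesian_product growth_def)
  thus "poly_bounded (\<lambda>n. card {y \<in> factors L. length y \<le> n})"
    using poly_bounded_mult[OF poly_bounded_mult[OF poly_bounded_const poly_bounded_add_const]
        poly_bounded_shift[OF poly[unfolded poly_growth_iff]]]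
    by (rule poly_bounded_mono[rotated])
qed

text \<open>A factor-closed set is used here because the longest suffix in it survives pops.\<close>

definition long_suffix :: "'b list set \<Rightarrow> 'b list \<Rightarrow> 'b list" where
  "long_suffix L y = drop (LEAST j. drop j y \<in> insert [] (factors L)) y"

lemma long_suffix_in: "long_suffix L y \<in> insert [] (factors L)"
  \<comment> \<open>Inserting \<open>[]\<close> guarantees a candidate also when \<open>L\<close>,
    and with it \<open>factors L\<close>, is empty.\<close>
  unfolding long_suffix_def by (rule LeastI[of _ "length y"]) simp

lemma length_long_suffix: "length (long_suffix L y) \<le> length y"
  by (simp add: long_suffix_def)

text \<open>A suffix of \<open>y\<close> that is a factor lies within the longest such suffix. By
  the equal lengths, the latter starts at the same position in \<open>y\<close> and
  \<open>y'\<close>.\<close>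

lemma long_suffix_eq_drop:
  assumes "length y = length y'" "long_suffix L y = long_suffix L y'" "drop j y \<in> factors L"
  shows "drop j y = drop j y'"
proof -
  define k where "k x = (LEAST j. drop j x \<in> insert [] (factors L))" for x
  have k: "long_suffix L x = drop (k x) x" for x by (simp add: long_suffix_def k_def)
  have le: "k x \<le> length x" for x unfolding k_def by (rule Least_le) simp
  have "length (drop (k y) y) = length (drop (k y') y')" using assms(2) by (simp add: k)
  hence eq: "k y = k y'" using le[of y] le[of y'] assms(1) by simp
  have "k y \<le> j" unfolding k_def by (rule Least_le) (use assms(3) in simp)
  hence "drop j x = drop (j - k y) (drop (k y) x)" for x :: "'a list" by simp
  thus ?thesis using assms(2) by (metis k eq)
qed

lemma left_reducible_imp_poly_range:
  fixes L :: "'a::finite list set"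
  assumes "left_reducible_to_regular_poly L"
  shows "poly_range (wcls L)"
proof -
  obtain Gam :: "nat set" and Q q0 and \<delta> :: "nat \<Rightarrow> 'a \<Rightarrow> nat \<times> nat" and K
    where Gam: "finite Gam" and M: "mealy Q Gam q0 \<delta>" and reg: "regular_on Gam K"
      and poly: "poly_growth K" and red: "\<And>x. x \<in> L \<longleftrightarrow> left_transduction \<delta> q0 x \<in> K"
    using assms unfolding left_reducible_to_regular_poly_def by blast
  define h where "h q u = long_suffix K (left_transduction \<delta> q u)" for q u
  note fac = poly_bounded_factors[OF Gam reg poly]
  have "poly_range (h q)" for q
  proof (rule poly_rangeI[where B = "\<lambda>n. insert [] {y \<in> factors K. length y \<le> n}"])
    show "poly_bounded (\<lambda>n. card (insert [] {y \<in> factors K. length y \<le> n}))"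
      by (rule poly_bounded_mono[OF poly_bounded_add[OF fac(2) poly_bounded_const[of 1]]])
        (simp add: card_insert_if fac(1))
    show "finite (insert [] {y \<in> factors K. length y \<le> n})" for n using fac(1) by simp
    fix w :: "'a list" and n assume "length w \<le> n"
    thus "h q w \<in> insert [] {y \<in> factors K. length y \<le> n}"
      using long_suffix_in[of K "left_transduction \<delta> q w"]
        length_long_suffix[of K "left_transduction \<delta> q w"]
      by (auto simp: h_def)
  qed
  hence "poly_range (\<lambda>w. \<lambda>q\<in>Q. h q w)"
    using M by (intro poly_range_restrict) (auto simp: mealy_def)
  thus ?thesis
  proof (rule poly_range_wclsI)
    fix u v :: "'a list" and j y
    assume len: "length u = length v" and h: "(\<lambda>q\<in>Q. h q u) = (\<lambda>q\<in>Q. h q v)"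
      and mem: "drop j u @ y \<in> L"
    \<comment> \<open>The machine reads \<open>y\<close> before the window, so it can meet the
      window in any state; therefore \<open>h\<close> is recorded for all states in
      \<open>Q\<close>.\<close>
    define q where "q = run (\<lambda>q b. fst (\<delta> q b)) q0 (rev y)"
    have "run (\<lambda>q b. fst (\<delta> q b)) p s \<in> Q" if "p \<in> Q" for p s
      using that by (induction s arbitrary: p) (use M in \<open>auto simp: mealy_def\<close>)
    hence "q \<in> Q" using M by (simp add: q_def mealy_def)
    hence eq: "h q u = h q v" using fun_cong[OF h, of q] by simp
    have split: "left_transduction \<delta> q0 (drop j w @ y)
        = drop j (left_transduction \<delta> q w) @ left_transduction \<delta> q0 y" for w
      by (simp add: left_transduction_append left_transduction_drop q_def)
    have K: "drop j (left_transduction \<delta> q u) @ left_transduction \<delta> q0 y \<in> K"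
      using mem by (simp add: red split)
    hence "[] @ drop j (left_transduction \<delta> q u) @ left_transduction \<delta> q0 y \<in> K" by simp
    hence "drop j (left_transduction \<delta> q u) \<in> factors K" unfolding factors_def by blast
    hence "drop j (left_transduction \<delta> q u) = drop j (left_transduction \<delta> q v)"
      by (intro long_suffix_eq_drop) (use len eq in \<open>auto simp: h_def\<close>)
    thus "drop j v @ y \<in> L" using K by (simp add: red split)
  qed
qed

section \<open>Left ideals and length languages\<close>

lemma poly_range_length_language:
  fixes K :: "'a::finite list set"
  assumes "length_language K"
  shows "poly_range (wcls K)"
proof (rule poly_range_wclsI[OF poly_range_length])
  fix u v :: "'a list" and j y
  assume "length u = length v" "drop j u @ y \<in> K"
  moreover from this have "length (drop j u @ y) = length (drop j v @ y)" by simp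
  ultimately show "drop j v @ y \<in> K" using assms unfolding length_language_def by blast
qed

lemma down_closed_eq_lessThan:
  fixes J :: "nat set"
  assumes "finite J" "\<And>i j. i \<in> J \<Longrightarrow> j \<le> i \<Longrightarrow> j \<in> J"
  shows "J = {..<card J}"
proof (cases "J = {}")
  case False
  have "J = {..Max J}"
    using assms Max_in[OF assms(1) False] Max_ge[OF assms(1)] by blast
  thus ?thesis by (metis card_atMost lessThan_Suc_atMost)
qed simp

text \<open>For fixed \<open>y\<close>, the cuts \<open>j\<close> with \<open>drop j u @ y\<close>
  in \<open>K\<close> form an initial segment, because longer suffixes stay in a left ideal; their
  number determines them. Only the set \<open>S\<close> of states that \<open>y\<close> sends to
  \<open>F\<close> matters, so finitely many numbers suffice.\<close>

lemma poly_range_left_ideal: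
  fixes K :: "'a::finite list set"
  assumes "regular K" "left_ideal K"
  shows "poly_range (wcls K)"
proof -
  obtain P p0 d F where A: "dfa UNIV P p0 d F" and K: "K = dfa_lang UNIV p0 d F"
    using assms(1) by (auto simp: regular_on_def)
  have inP: "run d p0 w \<in> P" for w using dfa_run_in[OF A] A by (simp add: dfa_def lists_UNIV)
  define J where "J S u = {j. j \<le> length u \<and> run d p0 (drop j u) \<in> S}" for S and u :: "'a list"
  have "poly_range (\<lambda>u. card (J S u))" for S
  proof (rule poly_rangeI[where B = "\<lambda>n. {..n + 1}"])
    fix w :: "'a list" and n assume n: "length w \<le> n"
    have "card (J S w) \<le> card {..length w}" by (rule card_mono) (auto simp: J_def)
    thus "card (J S w) \<in> {..n + 1}" using n by simp
  qed (use poly_bounded_add_const[of 2] in auto)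
  hence "poly_range (\<lambda>u. \<lambda>S\<in>Pow P. card (J S u))"
    using A by (intro poly_range_restrict) (auto simp: dfa_def)
  thus ?thesis
  proof (rule poly_range_wclsI)
    fix u v :: "'a list" and j y
    assume len: "length u = length v" "j \<le> length u"
      and eq: "(\<lambda>S\<in>Pow P. card (J S u)) = (\<lambda>S\<in>Pow P. card (J S v))"
      and mem: "drop j u @ y \<in> K"
    define S where "S = {p \<in> P. run d p y \<in> F}"
    have J: "J S w = {i. i \<le> length w \<and> drop i w @ y \<in> K}" for w
      using inP by (auto simp: J_def S_def K dfa_lang_def lists_UNIV)
    have "J S w = {..<card (J S w)}" for w
    proof (rule down_closed_eq_lessThan)
      show "finite (J S w)" by (rule finite_subset[of _ "{..length w}"]) (auto simp: J)
      fix i k assume i: "i \<in> J S w" and k: "k \<le> i"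
      have "drop k w = take (i - k) (drop k w) @ drop (i - k) (drop k w)"
        by (rule append_take_drop_id[symmetric])
      hence "drop k w @ y = take (i - k) (drop k w) @ (drop i w @ y)"
        using k by (metis append_assoc drop_drop le_add_diff_inverse2)
      moreover have "drop i w @ y \<in> K" using i by (simp add: J)
      ultimately have "drop k w @ y \<in> K" using assms(2) unfolding left_ideal_def by metis
      thus "k \<in> J S w" using i k by (simp add: J)
    qed
    moreover have "card (J S u) = card (J S v)"
      using fun_cong[OF eq, of S] by (simp add: S_def)
    ultimately have "J S u = J S v" by metis
    moreover have "j \<in> J S u" using len mem by (simp add: J)
    ultimately show "drop j v @ y \<in> K" by (simp add: J)
  qed
qed

section \<open>Boolean combinations\<close>

lemma bool_comb_imp_poly_range:
  fixes L :: "'a::finite list set"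
  assumes "bool_comb {K. regular K \<and> (left_ideal K \<or> length_language K)} L"
  shows "poly_range (wcls L)"
  using assms
  by induction (auto intro: poly_range_left_ideal poly_range_length_language
      poly_range_wcls_Compl poly_range_wcls_Int)

lemma bool_comb_Union:
  assumes "bool_comb G {}" "finite I" "\<And>i. i \<in> I \<Longrightarrow> bool_comb G (X i)"
  shows "bool_comb G (\<Union>i\<in>I. X i)"
  using assms(2,3)
proof (induction I)
  case (insert i I)
  have "bool_comb G (- (- X i \<inter> - (\<Union>i\<in>I. X i)))"
    by (rule bool_comb.compl[OF bool_comb.inter[OF bool_comb.compl bool_comb.compl]])
      (use insert in auto)
  thus ?case by simp
qed (simp add: assms(1))

lemma regular_length_mod:
  fixes m :: nat
  assumes "m > 0"
  shows "regular {w :: 'a list. length w mod m = r}"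
proof (rule regularI[of "\<lambda>w. length w mod m"])
  have "range (\<lambda>w :: 'a list. length w mod m) \<subseteq> {..<m}" using assms by auto
  thus "finite (range (\<lambda>w :: 'a list. length w mod m))" by (rule finite_subset) simp
  show "length (u @ [c]) mod m = length (v @ [c]) mod m"
    if "length u mod m = length v mod m" for u v :: "'a list" and c
    using that by (simp) (metis mod_Suc_eq)
qed simp

lemma well_behaved_imp_bool_comb:
  fixes L :: "'a list set"
  assumes W: "well_behaved_dfa UNIV Q q0 d F" and LA: "rev_lang L = dfa_lang UNIV q0 d F"
  shows "bool_comb {K. regular K \<and> (left_ideal K \<or> length_language K)} L"
    (is "bool_comb ?G L")
proof -
  have A: "dfa UNIV Q q0 d F" using W by (simp add: well_behaved_dfa_def)
  have fin: "finite Q" "finite F" using A by (auto simp: dfa_def intro: finite_subset)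
  have inQ: "run d q0 w \<in> Q" for w using dfa_run_in[OF A] A by (simp add: dfa_def lists_UNIV)
  have L_iff: "w \<in> L \<longleftrightarrow> run d q0 (rev w) \<in> F" for w
    using LA rev_lang_iff[of w L] by (simp add: dfa_lang_def lists_UNIV)
  \<comment> \<open>\<open>per e\<close> is the length of some nonempty loop at \<open>e\<close>; if
    there is none, any positive modulus will do.\<close>
  have "\<exists>m>0. (\<exists>y. y \<noteq> [] \<and> run d e y = e) \<longrightarrow> (\<exists>z. length z = m \<and> run d e z = e)" for e
    by (cases "\<exists>y. y \<noteq> [] \<and> run d e y = e") auto
  then obtain per where per: "\<And>e. per e > 0"
    and loop: "\<And>e y. y \<noteq> [] \<Longrightarrow> run d e y = e \<Longrightarrow> \<exists>z. length z = per e \<and> run d e z = e"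
    by metis
  \<comment> \<open>Extending \<open>w\<close> on the left prolongs the run on \<open>rev w\<close>:
    a visit to \<open>e\<close> persists, and once \<open>e\<close> is out of reach it stays so.
    Hence \<open>V\<close> and \<open>N\<close> give left ideals, and \<open>N\<close> enters
    complemented.\<close>
  define V where "V e r = {w. \<exists>x y. rev w = x @ y \<and> run d q0 x = e \<and> length x mod per e = r}" for e r
  define N where "N e = {w. \<not> reach UNIV d (run d q0 (rev w)) e}" for e
  define E where "E e r = {w :: 'a list. length w mod per e = r}" for e r
  have L: "L = (\<Union>e\<in>F. \<Union>r\<in>{..<per e}. V e r \<inter> (- N e \<inter> E e r))"
  proof (intro set_eqI iffI)
    fix w assume "w \<in> L"
    hence "run d q0 (rev w) \<in> F" by (simp add: L_iff)
    moreover let ?e = "run d q0 (rev w)"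
    have "w \<in> V ?e (length w mod per ?e) \<inter> (- N ?e \<inter> E ?e (length w mod per ?e))"
    proof
      show "w \<in> V ?e (length w mod per ?e)"
        unfolding V_def by (intro CollectI exI[of _ "rev w"] exI[of _ "[]"]) simp
    qed (simp add: N_def E_def)
    moreover have "length w mod per ?e \<in> {..<per ?e}" using per by simp
    ultimately show "w \<in> (\<Union>e\<in>F. \<Union>r\<in>{..<per e}. V e r \<inter> (- N e \<inter> E e r))" by blast
  next
    fix w assume "w \<in> (\<Union>e\<in>F. \<Union>r\<in>{..<per e}. V e r \<inter> (- N e \<inter> E e r))"
    then obtain e r where e: "e \<in> F" and "w \<in> V e r" "w \<notin> N e" "w \<in> E e r" by blast
    then obtain x y where xy: "rev w = x @ y" "run d q0 x = e"
      and md: "length x mod per e = length w mod per e"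
      by (auto simp: V_def E_def)
    have ret: "reach UNIV d (run d e y) e" using \<open>w \<notin> N e\<close> xy by (simp add: N_def)
    show "w \<in> L"
    proof (cases "y = []")
      \<comment> \<open>Here the run ends at its visit to \<open>e\<close>, and no loop at
        \<open>e\<close> has to exist.\<close>
      case True
      thus ?thesis using xy e by (simp add: L_iff)
    next
      case False
      obtain y' where "run d e (y @ y') = e" using ret by (auto elim: reachE)
      with False obtain z where z: "length z = per e" "run d e z = e"
        using loop[of "y @ y'" e] by auto
      have "length w = length x + length y" using xy(1) by (metis length_append length_rev)
      hence "per e dvd length y"
        using md by (metis add_diff_cancel_left' le_add1 mod_eq_dvd_iff_nat)
      then obtain k where k: "length y = per e * k" by blast
      \<comment> \<open>Repeating the loop gives a path from \<open>e\<close> to \<open>e\<close> as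
        long as \<open>y\<close>; well-behavedness then transfers acceptance from its end
        \<open>e\<close> to the end of \<open>y\<close>.\<close>
      define z' where "z' = concat (replicate k z)"
      have z': "run d e z' = e" "length z' = length y"
        unfolding z'_def by (rule run_concat_replicate[OF z(2)])
          (simp add: length_concat z(1) k sum_list_replicate)
      have "run d e y \<in> F \<longleftrightarrow> run d e z' \<in> F"
        by (rule well_behaved_dfaD[OF W]) (use xy(2) z' ret in auto)
      thus ?thesis using z' e xy by (simp add: L_iff)
    qed
  qed
  have "bool_comb ?G (V e r)" for e r
  proof (rule bool_comb.base, rule CollectI, rule conjI[OF _ disjI1])
    have "\<exists>x' y'. rev (u @ w) = x' @ y' \<and> run d q0 x' = e \<and> length x' mod per e = r"
      if "rev w = x @ y" "run d q0 x = e" "length x mod per e = r" for u w x y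
      using that by (intro exI[of _ x] exI[of _ "y @ rev u"]) simp
    thus "left_ideal (V e r)" unfolding left_ideal_def V_def by blast
    define S where "S = {s. \<exists>x y. s = x @ y \<and> run d q0 x = e \<and> length x mod per e = r}"
    have snoc: "s @ [c] \<in> S \<longleftrightarrow>
        s \<in> S \<or> run d q0 (s @ [c]) = e \<and> length (s @ [c]) mod per e = r" for s c
    proof
      assume "s @ [c] \<in> S"
      then obtain x y where "s @ [c] = x @ y" "run d q0 x = e" "length x mod per e = r"
        by (auto simp: S_def)
      thus "s \<in> S \<or> run d q0 (s @ [c]) = e \<and> length (s @ [c]) mod per e = r"
        by (cases y rule: rev_cases) (auto simp: S_def)
    next
      assume "s \<in> S \<or> run d q0 (s @ [c]) = e \<and> length (s @ [c]) mod per e = r"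
      thus "s @ [c] \<in> S"
      proof
        assume "s \<in> S"
        then obtain x y where "s = x @ y" "run d q0 x = e" "length x mod per e = r"
          by (auto simp: S_def)
        thus ?thesis unfolding S_def by (intro CollectI exI[of _ x] exI[of _ "y @ [c]"]) simp
      next
        assume "run d q0 (s @ [c]) = e \<and> length (s @ [c]) mod per e = r"
        thus ?thesis unfolding S_def by (intro CollectI exI[of _ "s @ [c]"] exI[of _ "[]"]) simp
      qed
    qed
    have "rev_lang (V e r) = S"
      by (intro set_eqI) (simp add: rev_lang_iff' V_def S_def)
    moreover have "regular S"
    \<comment> \<open>The automaton tracks the state, the length modulo \<open>per e\<close>, and
      whether a suitable visit has already occurred.\<close>
    proof (rule regularI[of "\<lambda>s. (run d q0 s, length s mod per e, s \<in> S)"])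
      have "range (\<lambda>s. (run d q0 s, length s mod per e, s \<in> S)) \<subseteq> Q \<times> {..<per e} \<times> UNIV"
        using inQ per by auto
      thus "finite (range (\<lambda>s. (run d q0 s, length s mod per e, s \<in> S)))"
        by (rule finite_subset) (use fin in auto)
      show "(run d q0 (u @ [c]), length (u @ [c]) mod per e, u @ [c] \<in> S) =
            (run d q0 (v @ [c]), length (v @ [c]) mod per e, v @ [c] \<in> S)"
        if "(run d q0 u, length u mod per e, u \<in> S) = (run d q0 v, length v mod per e, v \<in> S)"
        for u v c
      proof -
        have "length (u @ [c]) mod per e = length (v @ [c]) mod per e"
          using that by simp (metis mod_Suc_eq)
        with that show ?thesis unfolding snoc by simp
      qed
    qed simp
    ultimately show "regular (V e r)" using regular_by_rev_lang by metis
  qed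
  moreover have "bool_comb ?G (N e)" for e
  proof (rule bool_comb.base, rule CollectI, rule conjI[OF _ disjI1])
    show "left_ideal (N e)"
      unfolding left_ideal_def N_def by (auto dest: reach_trans[OF reach_run])
    have "regular {s. \<not> reach UNIV d (run d q0 s) e}"
    proof (rule regularI[of "run d q0"])
      show "finite (range (run d q0))" by (rule finite_subset[OF _ fin(1)]) (use inQ in auto)
    qed auto
    moreover have "rev_lang (N e) = {s. \<not> reach UNIV d (run d q0 s) e}"
      by (auto simp: rev_lang_iff' N_def)
    ultimately show "regular (N e)" using regular_by_rev_lang by metis
  qed
  moreover have "bool_comb ?G (E e r)" for e r
  proof (rule bool_comb.base, rule CollectI, rule conjI[OF _ disjI2])
    show "regular (E e r)" unfolding E_def using per by (rule regular_length_mod)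
    show "length_language (E e r)" by (auto simp: length_language_def E_def)
  qed
  moreover have "bool_comb ?G {}"
  proof (rule bool_comb.base, rule CollectI, rule conjI[OF _ disjI1])
    show "regular {}" by (rule regularI[of "\<lambda>_. ()"]) auto
  qed (simp add: left_ideal_def)
  ultimately show ?thesis
    unfolding L using fin(2) by (intro bool_comb_Union bool_comb.inter bool_comb.compl) auto
qed

theorem theorem5p5:
  fixes a :: "'a::finite" and L :: "'a list set"
  assumes "regular L"
  shows "(L \<in> F_log a \<longleftrightarrow> L \<in> V_log)
       \<and> (L \<in> F_log a \<longleftrightarrow> (\<exists>Q q0 \<delta> F. well_behaved_dfa UNIV Q q0 \<delta> F
                                \<and> rev_lang L = dfa_lang UNIV q0 \<delta> F))
       \<and> (L \<in> F_log a \<longleftrightarrow> left_reducible_to_regular_poly L)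
       \<and> (L \<in> F_log a \<longleftrightarrow> bool_comb {K. regular K \<and> (left_ideal K \<or> length_language K)} L)"
proof -
  let ?W = "\<exists>Q q0 \<delta> F. well_behaved_dfa UNIV Q q0 \<delta> F \<and> rev_lang L = dfa_lang UNIV q0 \<delta> F"
  \<comment> \<open>Two cycles are closed: from fixed-size to well-behaved, then either through
    reductions or through Boolean combinations to variable-size, and back to fixed-size.\<close>
  have "L \<in> V_log \<Longrightarrow> L \<in> F_log a" using V_log_subset_F_log[of a] by blast
  moreover have "L \<in> F_log a \<Longrightarrow> ?W"
    using regular_rev_lang[OF assms] F_log_imp_well_behaved[of L a]
    unfolding regular_on_def by blast
  moreover have "?W \<Longrightarrow> left_reducible_to_regular_poly L"
    using well_behaved_imp_left_reducible[OF assms] by blast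
  moreover have "left_reducible_to_regular_poly L \<Longrightarrow> L \<in> V_log"
    by (intro V_logI left_reducible_imp_poly_range)
  moreover have "?W \<Longrightarrow> bool_comb {K. regular K \<and> (left_ideal K \<or> length_language K)} L"
    using well_behaved_imp_bool_comb by blast
  moreover have "bool_comb {K. regular K \<and> (left_ideal K \<or> length_language K)} L \<Longrightarrow> L \<in> V_log"
    by (intro V_logI bool_comb_imp_poly_range)
  ultimately show ?thesis by argo
qed

end
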